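(* Fix $\alpha>0$ and let $r\in\mathbb{N}$. For any $0<\epsilon<1$ there exists an MLP neural network $\tilde{u}$, with $\tanh$ nonlinearities and $O(\epsilon^{-3/r}+\epsilon^{-1/r}\log^{2}(\epsilon^{-(1+1/r)}))$ weights (the implied constant depending on $r$), for which the following holds. For any $f\in W_{2}^{r}([0,1])$ of the form $f(x)=\sum_{k=1}^{\infty}c_{k}\sin(2\pi kx)$ with $\|f^{(r)}\|_{L_2[0,1]}\leq1$, let $u$ be the solution of the heat equation $u_t=\alpha u_{xx}$ on $[0,1]$ with initial condition $u(\cdot,0)=f$, i.e. $u(f,x,t)=\sum_{k=1}^\infty e^{-4\pi^2k^2\alpha t}c_k\sin(2\pi kx)$. Then the network $\tilde{u}$, taking as input the coefficients $\{c_{k}\}_{k=1}^{K}$ with $K\ge c\,\epsilon^{-1/r}$ (for a suitable constant $c>0$), together with $t$ and $x$, provides an output $\tilde u(f,x,t)$ satisfying \[ \|u(f,\cdot,t)-\tilde{u}(f,\cdot,t)\|_{L_{2}[0,1]}\leq\epsilon\qquad\text{for all } t\in[0,1]. \]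
   Context: An MLP (multilayer perceptron) network is a feed-forward composition of layers, each of the form $v_j=\sigma\circ(M_j v_{j-1}+b_j)$ with a matrix $M_j$ and bias vector $b_j$ and coordinate-wise nonlinearity $\sigma$ (here $\sigma=\tanh$); in some layers the bias and/or the nonlinearity may be omitted. The "number of weights" is the total number of parameters. For $\Omega\subset\mathbb{R}^n$ and $1\le p<\infty$, the Sobolev space $W_p^r(\Omega)$ is the completion of the space $C_0^r(\Omega)$ of compactly supported $r$-times continuously differentiable functions with respect to the norm $\|f\|_{W_p^r(\Omega)}=\sum_{|\beta|\le r}\|\partial^\beta f\|_{L_p(\Omega)}$. *)

theory Defs
  imports "HOL-Analysis.Analysis"
begin

text \<open>A layer is (M, b, s): M is the weight matrix given as a list of rows,
  b an optional bias vector, and s says whether tanh is applied coordinate-wise.\<close>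
type_synonym layer = "real list list \<times> real list option \<times> bool"

fun layer_wf :: "nat \<Rightarrow> layer \<Rightarrow> bool" where
  "layer_wf n (M, b, s) \<longleftrightarrow> M \<noteq> [] \<and> (\<forall>row\<in>set M. length row = n) \<and>
     (case b of None \<Rightarrow> True | Some v \<Rightarrow> length v = length M)"

fun mlp_wf :: "nat \<Rightarrow> layer list \<Rightarrow> bool" where
  "mlp_wf n [] \<longleftrightarrow> n = 1"
| "mlp_wf n (L # Ls) \<longleftrightarrow> layer_wf n L \<and> mlp_wf (length (fst L)) Ls"

fun eval_layer :: "layer \<Rightarrow> real list \<Rightarrow> real list" where
  "eval_layer (M, b, s) v =
     (let w = map (\<lambda>row. \<Sum>i<length row. row ! i * v ! i) M;
          w' = (case b of None \<Rightarrow> w | Some bb \<Rightarrow> map2 (+) w bb)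
      in if s then map tanh w' else w')"

definition mlp_eval :: "layer list \<Rightarrow> real list \<Rightarrow> real list" where
  "mlp_eval net v = fold eval_layer net v"

fun layer_weights :: "layer \<Rightarrow> nat" where
  "layer_weights (M, b, s) = sum_list (map length M) + (case b of None \<Rightarrow> 0 | Some bb \<Rightarrow> length bb)"

definition num_weights :: "layer list \<Rightarrow> nat" where
  "num_weights net = sum_list (map layer_weights net)"

definition C0r :: "nat \<Rightarrow> (real \<Rightarrow> real) \<Rightarrow> bool" where
  "C0r r \<phi> \<longleftrightarrow>
     (\<forall>j<r. \<forall>x. ((deriv ^^ j) \<phi> has_real_derivative (deriv ^^ Suc j) \<phi> x) (at x)) \<and>
     continuous_on UNIV ((deriv ^^ r) \<phi>) \<and>
     (\<exists>a b. 0 < a \<and> a \<le> b \<and> b < 1 \<and> (\<forall>x. x \<notin> {a..b} \<longrightarrow> \<phi> x = 0))"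

definition L2_norm01 :: "(real \<Rightarrow> real) \<Rightarrow> real" where
  "L2_norm01 g = sqrt (set_lebesgue_integral lborel {0..1} (\<lambda>x. (g x)^2))"

text \<open>D is an element of W_2^r([0,1]) together with its (weak) derivatives D 0 = f, D 1, ..., D r:
  it is the limit in the W_2^r norm of a sequence of C_0^r functions.\<close>
definition sobolev_W2 :: "nat \<Rightarrow> (nat \<Rightarrow> real \<Rightarrow> real) \<Rightarrow> bool" where
  "sobolev_W2 r D \<longleftrightarrow>
     (\<forall>j\<le>r. set_borel_measurable lborel {0..1} (D j) \<and>
             set_integrable lborel {0..1} (\<lambda>x. (D j x)^2)) \<and>
     (\<exists>\<phi>. (\<forall>n. C0r r (\<phi> n)) \<and>
        (\<forall>j\<le>r. (\<lambda>n. L2_norm01 (\<lambda>x. (deriv ^^ j) (\<phi> n) x - D j x)) \<longlonglongrightarrow> 0))"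

definition sine_series :: "(real \<Rightarrow> real) \<Rightarrow> (nat \<Rightarrow> real) \<Rightarrow> bool" where
  "sine_series f c \<longleftrightarrow>
     (\<forall>x\<in>{0..1}. (\<lambda>k. c (Suc k) * sin (2 * pi * real (Suc k) * x)) sums f x)"

definition admissible :: "nat \<Rightarrow> (real \<Rightarrow> real) \<Rightarrow> (nat \<Rightarrow> real) \<Rightarrow> bool" where
  "admissible r f c \<longleftrightarrow> sine_series f c \<and>
     (\<exists>D. D 0 = f \<and> sobolev_W2 r D \<and> L2_norm01 (D r) \<le> 1)"

definition heat_sol :: "real \<Rightarrow> (nat \<Rightarrow> real) \<Rightarrow> real \<Rightarrow> real \<Rightarrow> real" where
  "heat_sol \<alpha> c x t =
     (\<Sum>k. exp (- 4 * pi^2 * (real (Suc k))^2 * \<alpha> * t) * c (Suc k) * sin (2 * pi * real (Suc k) * x))"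

definition net_out :: "layer list \<Rightarrow> nat \<Rightarrow> (nat \<Rightarrow> real) \<Rightarrow> real \<Rightarrow> real \<Rightarrow> real" where
  "net_out net K c x t = hd (mlp_eval net (map c [1..<K+1] @ [t, x]))"

end

(* A single tanh unit reproduces exponentials: M (1 + tanh ((y - ln M) / 2)) / 2 tends to exp y as M
   grows, so one hidden layer with N units approximates any sum of N exponentials of linear forms
   in the input as well as desired. The truncated solution is close to such a sum with O(K^2) terms:
   c_k is replaced by (exp (h c_k) - 1) / h, the factor exp (- 4 pi^2 k^2 alpha t) is already of this
   form, and sin (2 pi k x) is a Taylor polynomial of degree O(K) in x, where in turn x is replaced
   by (exp (h x) - 1) / h. With K of order eps^(-1/r) this costs O(K^3) weights.

   The truncation error needs the c_k to be the Fourier coefficients of f, although the sine series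
   is only assumed to converge pointwise and f agrees with its continuous Sobolev representative g
   only almost everywhere. As in Riemann's uniqueness theory, the twice formally integrated series F
   has f as its symmetric second derivative, so F - G with G'' = g has second derivative zero outside a
   null set N. Adding a small multiple of a convex function whose second derivative is infinite on N
   yields, by the maximum principle, that F - G is affine. Bessel's inequality for the r-th
   derivatives of the approximating functions then bounds the sum of (2 pi k)^(2 r) c_k^2. *)

theory Submission
  imports Defs
begin

section \<open>Networks for sums of exponentials\<close>

text \<open>Weights are counted, not measured, so the gain \<open>M\<close> and the difference steps
  \<open>h\<close> are free and their errors can be made as small as desired. The cost is the number
  of exponentials: 2 K m of them, for K modes, m powers in each sine expansion and two exponentials
  per coefficient. Exponentials are suitable because the solution multiplies its inputs: a product
  of exponentials of single inputs is one exponential of a linear form, hence one hidden unit. The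
  error that forces m to grow with K is the Taylor remainder exp (6 pi K - m); taking m = (26 + r) K
  brings it below a fraction of \<epsilon>.

  On the analytic side the obstacle is that a series known only to converge pointwise cannot be
  integrated term by term against a sine. Dividing its coefficients by k^2 restores uniform
  convergence once they are known to be bounded, and the price is that the link between f and the
  integrated series survives only through second differences.\<close>

lemma scaled_tanh_eq:
  fixes M y :: real
  assumes "M > 0"
  shows "M / 2 + M / 2 * tanh (y / 2 - ln M / 2) = 1 / (1 / M + exp (- y))"
proof -
  have "exp (- 2 * (y / 2 - ln M / 2)) = M * exp (- y)"
    using assms by (simp add: algebra_simps exp_diff exp_minus) (simp add: field_simps)
  moreover have "1 + M * exp (- y) > 0"
    using assms by (simp add: add_pos_pos)
  ultimately show ?thesis
    using assms unfolding tanh_real_altdef by (simp add: field_simps)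
qed

text \<open>By \<open>scaled_tanh_eq\<close> the unit is the logistic function M / (1 + M exp (-
  y)). It stays below exp y, since it saturates at M, and the gap is controlled by dropping 1 / M
  from the denominator.\<close>

lemma scaled_tanh_approx:
  fixes M y :: real
  assumes "M > 0"
  shows "\<bar>M / 2 + M / 2 * tanh (y / 2 - ln M / 2) - exp y\<bar> \<le> exp (2 * y) / M"
proof -
  have pos: "1 / M + exp (- y) > 0"
    using assms by (simp add: add_pos_pos)
  have "exp y - 1 / (1 / M + exp (- y)) = exp y / M / (1 / M + exp (- y))"
    using pos assms by (simp add: field_simps exp_minus)
  also have "\<dots> \<le> exp y / M / exp (- y)"
    using assms by (intro divide_left_mono) (auto intro!: mult_pos_pos add_pos_pos)
  also have "\<dots> = exp (2 * y) / M"
    by (simp add: exp_minus exp_double power2_eq_square divide_simps)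
  finally have "exp y - 1 / (1 / M + exp (- y)) \<le> exp (2 * y) / M" .
  moreover have "1 / (1 / M + exp (- y)) \<le> 1 / exp (- y)"
    using assms by (intro divide_left_mono) (auto intro!: mult_pos_pos add_pos_pos)
  moreover have "1 / exp (- y) = exp y" "0 \<le> exp (2 * y) / M"
    using assms by (simp_all add: exp_minus divide_inverse)
  ultimately show ?thesis
    unfolding scaled_tanh_eq[OF assms] by linarith
qed

lemma one_hidden_layer_net:
  fixes p q d :: "nat \<Rightarrow> real" and w :: "nat \<Rightarrow> nat \<Rightarrow> real" and e :: real
  assumes "N > 0"
  shows "\<exists>net. mlp_wf n net \<and> num_weights net = N * (n + 2) + 1 \<and>
    (\<forall>v. length v = n \<longrightarrow>
       hd (mlp_eval net v) = (\<Sum>i<N. p i * tanh ((\<Sum>j<n. w i j * v ! j) + d i)) + e)"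
proof (intro exI conjI allI impI)
  let ?net = "[(map (\<lambda>i. map (w i) [0..<n]) [0..<N], Some (map d [0..<N]), True),
               ([map p [0..<N]], Some [e], False)]"
  show "mlp_wf n ?net"
    using assms by auto
  have "map (length \<circ> (\<lambda>i. map (w i) [0..<n])) [0..<N] = replicate N n"
    by (intro nth_equalityI) auto
  then show "num_weights ?net = N * (n + 2) + 1"
    by (simp add: num_weights_def sum_list_replicate)
  fix v :: "real list"
  assume "length v = n"
  moreover have "map2 (+) (map g [0..<N]) (map d [0..<N]) = map (\<lambda>i. g i + d i) [0..<N]"
    for g :: "nat \<Rightarrow> real"
    by (intro nth_equalityI) auto
  ultimately show "hd (mlp_eval ?net v) = (\<Sum>i<N. p i * tanh ((\<Sum>j<n. w i j * v ! j) + d i)) + e"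
    by (simp add: mlp_eval_def Let_def comp_def)
qed

text \<open>All units share one gain \<open>M\<close>, hence one bias \<open>q\<close>; the weights
  are halved because tanh is applied to half the exponent. The exact tanh formula is exported
  besides the error bound because continuity of the output in x is needed later without any
  restriction on the inputs.\<close>

lemma exp_sum_net:
  fixes a :: "'i \<Rightarrow> real" and w :: "'i \<Rightarrow> nat \<Rightarrow> real"
  assumes "finite I" "I \<noteq> {}" "\<delta> > 0"
  obtains net p q e where "mlp_wf n net" "num_weights net = card I * (n + 2) + 1"
    "\<And>v. length v = n \<Longrightarrow>
       hd (mlp_eval net v) = (\<Sum>i\<in>I. p i * tanh ((\<Sum>j<n. w i j / 2 * v ! j) + q)) + e"
    "\<And>v. length v = n \<Longrightarrow> (\<And>j. j < n \<Longrightarrow> \<bar>v ! j\<bar> \<le> B) \<Longrightarrow>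
       \<bar>hd (mlp_eval net v) - (\<Sum>i\<in>I. a i * exp (\<Sum>j<n. w i j * v ! j))\<bar> \<le> \<delta>"
proof -
  obtain h where h: "bij_betw h {..<card I} I"
    using ex_bij_betw_nat_finite[OF assms(1)] by (auto simp: atLeast0LessThan)
  \<comment> \<open>\<open>Y\<close> dominates the total of \<bar>a i\<bar> exp (2 y) over all
    inputs with entries at most \<open>B\<close>, so the summed unit errors are at most Y / M. The
    added 1 below keeps \<open>M\<close> positive even if all \<open>a i\<close> vanish.\<close>
  define Y where "Y = (\<Sum>i\<in>I. \<bar>a i\<bar> * exp (2 * (\<Sum>j<n. \<bar>w i j\<bar> * B)))"
  define M where "M = (Y + 1) / \<delta>"
  have "Y \<ge> 0"
    unfolding Y_def by (intro sum_nonneg) auto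
  then have "M > 0" "Y \<le> M * \<delta>"
    using assms(3) by (simp_all add: M_def)
  then have M: "M > 0" "Y / M \<le> \<delta>"
    by (simp_all add: pos_divide_le_eq mult.commute)
  have cI: "card I > 0"
    using assms by (simp add: card_gt_0_iff)
  obtain net where net: "mlp_wf n net" "num_weights net = card I * (n + 2) + 1"
    "\<And>v. length v = n \<Longrightarrow>
       hd (mlp_eval net v) = (\<Sum>i<card I. a (h i) * M / 2 * tanh ((\<Sum>j<n. w (h i) j / 2 * v ! j) + - ln M / 2))
         + (\<Sum>i\<in>I. a i * M / 2)"
    using one_hidden_layer_net[OF cI, where n = n and p = "\<lambda>i. a (h i) * M / 2"
          and w = "\<lambda>i j. w (h i) j / 2" and d = "\<lambda>_. - ln M / 2" and e = "\<Sum>i\<in>I. a i * M / 2"] by blast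
  have eval: "hd (mlp_eval net v) = (\<Sum>i\<in>I. a i * M / 2 * tanh ((\<Sum>j<n. w i j / 2 * v ! j) + - ln M / 2))
      + (\<Sum>i\<in>I. a i * M / 2)" if "length v = n" for v
    unfolding net(3)[OF that]
    using sum.reindex_bij_betw[OF h, of "\<lambda>i. a i * M / 2 * tanh ((\<Sum>j<n. w i j / 2 * v ! j) + - ln M / 2)"]
    by (rule arg_cong2[where f = "(+)", OF _ refl])
  show ?thesis
  proof (rule that[of net "\<lambda>i. a i * M / 2" "- ln M / 2" "\<Sum>i\<in>I. a i * M / 2", OF net(1,2) eval])
    fix v :: "real list"
    assume v: "length v = n" "\<And>j. j < n \<Longrightarrow> \<bar>v ! j\<bar> \<le> B"
    let ?y = "\<lambda>i. \<Sum>j<n. w i j * v ! j"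
    have eq: "hd (mlp_eval net v) - (\<Sum>i\<in>I. a i * exp (?y i))
        = (\<Sum>i\<in>I. a i * (M / 2 + M / 2 * tanh (?y i / 2 - ln M / 2) - exp (?y i)))"
    proof -
      have "?y i / 2 - ln M / 2 = (\<Sum>j<n. w i j / 2 * v ! j) + - ln M / 2" for i
        by (simp add: sum_divide_distrib)
      then show ?thesis
        unfolding eval[OF v(1)] sum.distrib[symmetric] sum_subtractf[symmetric]
        by (intro sum.cong) (simp_all add: right_diff_distrib distrib_left)
    qed
    have "\<bar>hd (mlp_eval net v) - (\<Sum>i\<in>I. a i * exp (?y i))\<bar>
        \<le> (\<Sum>i\<in>I. \<bar>a i\<bar> * exp (2 * (\<Sum>j<n. \<bar>w i j\<bar> * B)) / M)"
      unfolding eq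
    proof (rule order_trans[OF sum_abs], rule sum_mono)
      fix i
      have "?y i \<le> (\<Sum>j<n. \<bar>w i j\<bar> * B)"
      proof (rule sum_mono)
        fix j
        assume "j \<in> {..<n}"
        then have "\<bar>w i j * v ! j\<bar> \<le> \<bar>w i j\<bar> * B"
          using v(2)[of j] by (simp add: abs_mult mult_left_mono)
        then show "w i j * v ! j \<le> \<bar>w i j\<bar> * B"
          by linarith
      qed
      then have "exp (2 * ?y i) / M \<le> exp (2 * (\<Sum>j<n. \<bar>w i j\<bar> * B)) / M"
        using M by (intro divide_right_mono) auto
      with scaled_tanh_approx[OF M(1), of "?y i"]
      have "\<bar>M / 2 + M / 2 * tanh (?y i / 2 - ln M / 2) - exp (?y i)\<bar>
          \<le> exp (2 * (\<Sum>j<n. \<bar>w i j\<bar> * B)) / M"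
        by linarith
      from mult_left_mono[OF this, of "\<bar>a i\<bar>"]
      show "\<bar>a i * (M / 2 + M / 2 * tanh (?y i / 2 - ln M / 2) - exp (?y i))\<bar>
          \<le> \<bar>a i\<bar> * exp (2 * (\<Sum>j<n. \<bar>w i j\<bar> * B)) / M"
        by (simp add: abs_mult)
    qed
    also have "\<dots> = Y / M"
      by (simp add: Y_def sum_divide_distrib)
    finally show "\<bar>hd (mlp_eval net v) - (\<Sum>i\<in>I. a i * exp (?y i))\<bar> \<le> \<delta>"
      using M(2) by linarith
  qed
qed

section \<open>Approximation of linear functions, polynomials and sines by sums of
  exponentials\<close>

text \<open>One term of the series of exp (3 y) is at most its sum, and 3 exceeds Euler's number, so
  3^n beats exp n. This turns the Taylor remainder of the sine into exponential decay as soon as the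
  degree passes 3 y.\<close>

lemma power_over_fact_le_exp:
  fixes y :: real
  assumes "y \<ge> 0"
  shows "y ^ n / fact n \<le> exp (3 * y - real n)"
proof -
  have "(\<Sum>i\<in>{n}. (3 * y) ^ i /\<^sub>R fact i) \<le> (\<Sum>i. (3 * y) ^ i /\<^sub>R fact i)"
    by (rule sum_le_suminf[OF summable_exp_generic]) (use assms in auto)
  then have "3 ^ n * (y ^ n / fact n) \<le> exp (3 * y)"
    by (simp add: exp_def power_mult_distrib divide_inverse mult_ac)
  moreover have "exp (real n) \<le> 3 ^ n"
    using power_mono[OF exp_le, of n] by (simp flip: exp_of_nat_mult)
  then have "exp (real n) * (y ^ n / fact n) \<le> 3 ^ n * (y ^ n / fact n)"
    using assms by (intro mult_right_mono) auto
  ultimately show ?thesis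
    by (simp add: exp_diff field_simps)
qed

text \<open>For negative z this follows from 1 - z \<le> exp (- z) together with the factorization
  of 1 - z^3.\<close>

lemma exp_le_quadratic:
  fixes z :: real
  assumes "\<bar>z\<bar> \<le> 1"
  shows "exp z \<le> 1 + z + z\<^sup>2"
proof (cases "z \<ge> 0")
  case True
  then show ?thesis
    using assms exp_bound by auto
next
  case False
  have "(1 - z) * exp z \<le> exp (- z) * exp z"
    using exp_ge_add_one_self[of "- z"] by (intro mult_right_mono) auto
  also have "\<dots> = 1"
    by (simp add: exp_minus)
  also have "\<dots> \<le> 1 - z ^ 3"
    using False by (simp add: power_less_zero_eq less_imp_le)
  also have "\<dots> = (1 - z) * (1 + z + z\<^sup>2)"
    by (simp add: power2_eq_square power3_eq_cube algebra_simps)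
  finally show ?thesis
    using False by (subst (asm) mult_le_cancel_left_pos) auto
qed

text \<open>The difference quotient of exp at 0 in direction c tends to c, with an error of at most
  h c^2 by the quadratic bounds on exp.\<close>

lemma exp_quotient_approx:
  fixes B \<tau> :: real
  assumes "\<tau> > 0"
  obtains h where "h > 0" "\<And>c. \<bar>c\<bar> \<le> B \<Longrightarrow> \<bar>(exp (h * c) - 1) / h - c\<bar> \<le> \<tau>"
proof -
  \<comment> \<open>The first entry keeps \<bar>h c\<bar> within 1, where the quadratic bound
    applies; the second makes h c^2 at most \<tau>. Using \<bar>B\<bar> + 1 avoids a zero
    denominator.\<close>
  define h where "h = min (1 / (\<bar>B\<bar> + 1)) (\<tau> / (\<bar>B\<bar> + 1)\<^sup>2)"
  have "h > 0" "h \<le> 1 / (\<bar>B\<bar> + 1)" "h \<le> \<tau> / (\<bar>B\<bar> + 1)\<^sup>2"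
    using assms by (auto simp: h_def)
  then have h: "h > 0" "h * (\<bar>B\<bar> + 1) \<le> 1" "h * (\<bar>B\<bar> + 1)\<^sup>2 \<le> \<tau>"
    by (simp_all add: pos_le_divide_eq)
  show ?thesis
  proof (rule that[OF h(1)])
    fix c :: real
    assume "\<bar>c\<bar> \<le> B"
    then have c: "\<bar>c\<bar> \<le> \<bar>B\<bar> + 1"
      by simp
    have "\<bar>h * c\<bar> \<le> h * (\<bar>B\<bar> + 1)"
      using h(1) c by (simp add: abs_mult)
    then have "norm (h * c) \<le> 1"
      using h(2) by simp
    then have "exp (h * c) \<le> 1 + h * c + (h * c)\<^sup>2"
      by (intro exp_le_quadratic) auto
    moreover have "1 + h * c \<le> exp (h * c)"
      by simp
    ultimately have "\<bar>exp (h * c) - 1 - h * c\<bar> \<le> (h * c)\<^sup>2"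
      by linarith
    moreover have "c\<^sup>2 \<le> (\<bar>B\<bar> + 1)\<^sup>2"
      using power_mono[OF c, of 2] by simp
    then have "h * c\<^sup>2 \<le> \<tau>"
      using h(1,3) by (meson less_imp_le mult_left_mono order_trans)
    then have "(h * c)\<^sup>2 \<le> \<tau> * h"
      using mult_right_mono[of "h * c\<^sup>2" \<tau> h] h(1) by (simp add: power2_eq_square mult_ac)
    ultimately have "\<bar>exp (h * c) - 1 - h * c\<bar> \<le> \<tau> * h"
      by linarith
    moreover have "(exp (h * c) - 1) / h - c = (exp (h * c) - 1 - h * c) / h"
      using h(1) by (simp add: diff_divide_distrib)
    ultimately show "\<bar>(exp (h * c) - 1) / h - c\<bar> \<le> \<tau>"
      using h(1) by (simp add: pos_divide_le_eq)
  qed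
qed

text \<open>Replacing x by (exp (h x) - 1) / h changes P little, and turns it into a polynomial in
  exp (h x). The substitution is affine in exp (h x), so the degree is kept and m exponentials still
  suffice.\<close>

lemma poly_exp_sum_approx:
  fixes P :: "real poly" and \<tau> :: real
  assumes "degree P < m" "\<tau> > 0"
  shows "\<exists>a \<eta>. \<forall>x\<in>{0..1}. \<bar>poly P x - (\<Sum>j<m. a j * exp (real j * \<eta> * x))\<bar> \<le> \<tau>"
proof -
  \<comment> \<open>The interval exceeds [0, 1] on both sides by 1, the distance by which the
    substituted point may leave it.\<close>
  have "uniformly_continuous_on {-1..2} (poly P)"
    by (intro compact_uniformly_continuous) (auto intro!: continuous_intros)
  then obtain d where d: "d > 0"
    "\<And>x y. x \<in> {-1..2} \<Longrightarrow> y \<in> {-1..2} \<Longrightarrow> dist y x < d \<Longrightarrow> dist (poly P y) (poly P x) < \<tau>"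
    using assms(2) unfolding uniformly_continuous_on_def by metis
  obtain h where h: "h > 0" "\<And>x. \<bar>x\<bar> \<le> 1 \<Longrightarrow> \<bar>(exp (h * x) - 1) / h - x\<bar> \<le> min (d / 2) 1"
    using exp_quotient_approx[of "min (d / 2) 1" 1] d(1) by auto
  define Q where "Q = pcompose P [:- 1 / h, 1 / h:]"
  have "degree Q < m"
    using assms(1) h(1) by (simp add: Q_def degree_pcompose)
  have Q: "poly Q y = (\<Sum>j<m. coeff Q j * y ^ j)" for y
    unfolding poly_altdef using \<open>degree Q < m\<close>
    by (intro sum.mono_neutral_left) (auto simp: coeff_eq_0)
  have "\<bar>poly P x - (\<Sum>j<m. coeff Q j * exp (real j * h * x))\<bar> \<le> \<tau>" if x: "x \<in> {0..1}" for x
  proof -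
    let ?y = "(exp (h * x) - 1) / h"
    have y: "\<bar>?y - x\<bar> \<le> min (d / 2) 1"
      using h(2) x by simp
    have "dist (poly P ?y) (poly P x) < \<tau>"
    proof (rule d(2))
      show "x \<in> {-1..2}" "?y \<in> {-1..2}"
        using x y by auto
      show "dist ?y x < d"
        using y d(1) unfolding dist_real_def by linarith
    qed
    moreover have "poly P ?y = poly Q (exp (h * x))"
      by (simp add: Q_def poly_pcompose diff_divide_distrib)
    moreover have "exp (h * x) ^ j = exp (real j * h * x)" for j
      by (simp add: mult.assoc flip: exp_of_nat_mult)
    ultimately show ?thesis
      by (simp add: Q dist_real_def abs_minus_commute)
  qed
  then show ?thesis
    by blast
qed

text \<open>The Taylor polynomial of degree below m leaves a remainder of at most \<omega>^m / m!,
  which is small once m is well above 3 \<omega>; \<tau> pays for passing from powers of x to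
  exponentials.\<close>

lemma sin_exp_sum_approx:
  fixes \<omega> \<tau> :: real
  assumes "\<omega> \<ge> 0" "m > 0" "\<tau> > 0"
  shows "\<exists>a \<eta>. \<forall>x\<in>{0..1}.
    \<bar>sin (\<omega> * x) - (\<Sum>j<m. a j * exp (real j * \<eta> * x))\<bar> \<le> exp (3 * \<omega> - real m) + \<tau>"
proof -
  define P where "P = (\<Sum>i<m. monom (sin_coeff i * \<omega> ^ i) i)"
  have P: "poly P x = (\<Sum>i<m. sin_coeff i * (\<omega> * x) ^ i)" for x
    by (simp add: P_def poly_sum poly_monom power_mult_distrib mult.assoc)
  have "degree P < m"
    unfolding P_def
    by (intro degree_sum_less) (use assms(2) in \<open>auto intro: le_less_trans[OF degree_monom_le]\<close>)
  from poly_exp_sum_approx[OF this assms(3)] obtain a \<eta> where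
    a: "\<And>x. x \<in> {0..1} \<Longrightarrow> \<bar>poly P x - (\<Sum>j<m. a j * exp (real j * \<eta> * x))\<bar> \<le> \<tau>"
    by blast
  have "\<bar>sin (\<omega> * x) - poly P x\<bar> \<le> exp (3 * \<omega> - real m)" if x: "x \<in> {0..1}" for x
  proof -
    have "\<bar>sin (\<omega> * x) - poly P x\<bar> \<le> inverse (fact m) * \<bar>\<omega> * x\<bar> ^ m"
      unfolding P by (rule Maclaurin_sin_bound)
    also have "\<dots> \<le> inverse (fact m) * \<omega> ^ m"
      using assms(1) x by (intro mult_left_mono power_mono) (auto simp: abs_mult mult_left_le)
    also have "\<dots> \<le> exp (3 * \<omega> - real m)"
      using power_over_fact_le_exp[OF assms(1), of m] by (simp add: divide_inverse mult.commute)
    finally show ?thesis .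
  qed
  then have "\<bar>sin (\<omega> * x) - (\<Sum>j<m. a j * exp (real j * \<eta> * x))\<bar> \<le> exp (3 * \<omega> - real m) + \<tau>"
    if "x \<in> {0..1}" for x
    using a[OF that] that by fastforce
  then show ?thesis
    by blast
qed

text \<open>The exponentials are indexed by a mode k, a power j in the expansion of its sine, and a
  Boolean telling apart the two terms of (exp (h c) - 1) / h. Each of the 2 K m units has K + 2
  input weights, a bias and an output weight; one output bias is added. The bound 2 on the
  coefficients is the one that admissible initial data satisfy.\<close>

lemma heat_net:
  fixes \<alpha> \<delta> :: real
  assumes "K > 0" "m > 0" "\<delta> > 0" "\<alpha> \<ge> 0"
  shows "\<exists>net. mlp_wf (K + 2) net \<and> num_weights net = 2 * K * m * (K + 4) + 1 \<and>
    (\<forall>c t. continuous_on UNIV (\<lambda>x. net_out net K c x t)) \<and>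
    (\<forall>c. (\<forall>k\<in>{1..K}. \<bar>c k\<bar> \<le> 2) \<longrightarrow> (\<forall>t\<in>{0..1}. \<forall>x\<in>{0..1}.
      \<bar>net_out net K c x t - (\<Sum>k=1..K. exp (- 4 * pi^2 * (real k)^2 * \<alpha> * t) * c k * sin (2 * pi * real k * x))\<bar>
        \<le> 3 * real K * exp (6 * pi * real K - real m) + \<delta>))"
proof -
  \<comment> \<open>Each mode contributes an error of 4 \<tau> from the two difference quotients, so
    K modes use half of \<delta>; the tanh units get the other half.\<close>
  define \<tau> where "\<tau> = min 1 (\<delta> / (8 * real K))"
  have \<tau>: "\<tau> > 0" "\<tau> \<le> 1" "real K * (4 * \<tau>) \<le> \<delta> / 2"
  proof -
    have "\<tau> \<le> \<delta> / (8 * real K)"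
      by (simp add: \<tau>_def)
    then show "real K * (4 * \<tau>) \<le> \<delta> / 2"
      using assms(1) by (simp add: pos_le_divide_eq mult.commute)
  qed (use assms in \<open>auto simp: \<tau>_def\<close>)
  obtain h where h: "h > 0" "\<And>c. \<bar>c\<bar> \<le> 2 \<Longrightarrow> \<bar>(exp (h * c) - 1) / h - c\<bar> \<le> \<tau>"
    using exp_quotient_approx[OF \<tau>(1), of 2] by blast
  have "\<forall>k. \<exists>a \<eta>. \<forall>x\<in>{0..1}. \<bar>sin (2 * pi * real k * x) - (\<Sum>j<m. a j * exp (real j * \<eta> * x))\<bar>
      \<le> exp (3 * (2 * pi * real k) - real m) + \<tau>"
    by (intro allI sin_exp_sum_approx) (use assms \<tau> in auto)
  from choice[OF this] obtain A where "\<forall>k. \<exists>\<eta>. \<forall>x\<in>{0..1}.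
      \<bar>sin (2 * pi * real k * x) - (\<Sum>j<m. A k j * exp (real j * \<eta> * x))\<bar>
      \<le> exp (3 * (2 * pi * real k) - real m) + \<tau>" ..
  from choice[OF this] obtain \<eta> where A: "\<forall>k. \<forall>x\<in>{0..1}.
      \<bar>sin (2 * pi * real k * x) - (\<Sum>j<m. A k j * exp (real j * \<eta> k * x))\<bar>
      \<le> exp (3 * (2 * pi * real k) - real m) + \<tau>" ..
  define I where "I = {1..K} \<times> {..<m} \<times> (UNIV :: bool set)"
  define a where "a = (\<lambda>(k, j, b). (if b then 1 else - 1) * A k j / h)"
  \<comment> \<open>The inputs stand in the order c 1, ..., c K, t, x and are counted from 0: c k is
    entry k - 1, t is entry K and x is entry K + 1.\<close>
  define w where "w = (\<lambda>(k, j, b) i. (if i = K then - 4 * pi^2 * (real k)^2 * \<alpha> else 0)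
      + (if i = K + 1 then real j * \<eta> k else 0) + (if i = k - 1 then if b then h else 0 else 0))"
  have I: "finite I" "I \<noteq> {}" "card I = 2 * K * m"
    using assms(1,2) by (auto simp: I_def card_cartesian_product)
  have "\<delta> / 2 > 0"
    using assms(3) by simp
  obtain net p q e where net: "mlp_wf (K + 2) net" "num_weights net = card I * (K + 2 + 2) + 1"
    "\<And>v. length v = K + 2 \<Longrightarrow>
       hd (mlp_eval net v) = (\<Sum>i\<in>I. p i * tanh ((\<Sum>j<K + 2. w i j / 2 * v ! j) + q)) + e"
    "\<And>v. length v = K + 2 \<Longrightarrow> (\<And>j. j < K + 2 \<Longrightarrow> \<bar>v ! j\<bar> \<le> 2) \<Longrightarrow>
       \<bar>hd (mlp_eval net v) - (\<Sum>i\<in>I. a i * exp (\<Sum>j<K + 2. w i j * v ! j))\<bar> \<le> \<delta> / 2"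
    by (rule exp_sum_net[OF I(1,2) \<open>\<delta> / 2 > 0\<close>, where n = "K + 2" and w = w and a = a and B = 2]) blast
  let ?v = "\<lambda>c t x. map c [1..<K+1] @ [t, x :: real]"
  have nth: "?v c t x ! j = (if j < K then c (Suc j) else if j = K then t else x)" if "j < K + 2" for c t x j
  proof -
    have "[1..<K + 1] ! j = Suc j" if "j < K" for j
      using that by (subst nth_upt) auto
    then show ?thesis
      using that by (auto simp: nth_append nth_Cons' less_Suc_eq simp del: upt_Suc)
  qed
  have dot: "(\<Sum>j<K + 2. u j * ?v c t x ! j)
      = (\<Sum>j<K + 2. u j * (if j < K then c (Suc j) else if j = K then t else x))" for u c t x
    by (intro sum.cong refl arg_cong2[where f = "(*)"] nth) auto
  have cont: "continuous_on UNIV (\<lambda>x. net_out net K c x t)" for c t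
  proof -
    have "continuous_on UNIV (\<lambda>x. (\<Sum>i\<in>I. p i * tanh ((\<Sum>j<K + 2. w i j / 2 *
        (if j < K then c (Suc j) else if j = K then t else x)) + q)) + e)"
    proof -
      have "continuous_on UNIV (\<lambda>x. if P then u else if Q then t else x)" for P Q u
        by (cases P; cases Q) (auto intro: continuous_intros)
      then show ?thesis
        by (intro continuous_intros) auto
    qed
    moreover have "length (?v c t x) = K + 2" for x
      by simp
    ultimately show ?thesis
      unfolding net_out_def by (simp only: net(3) dot)
  qed
  have approx: "\<bar>net_out net K c x t - (\<Sum>k=1..K. exp (- 4 * pi^2 * (real k)^2 * \<alpha> * t) * c k * sin (2 * pi * real k * x))\<bar>
        \<le> 3 * real K * exp (6 * pi * real K - real m) + \<delta>"
    if c: "\<forall>k\<in>{1..K}. \<bar>c k\<bar> \<le> 2" and t: "t \<in> {0..1}" and x: "x \<in> {0..1}" for c t x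
  proof -
    define S where "S = (\<lambda>k. \<Sum>j<m. A k j * exp (real j * \<eta> k * x))"
    define E where "E = (\<lambda>k. (exp (h * c k) - 1) / h)"
    define D where "D = (\<lambda>k. exp (- 4 * pi^2 * (real k)^2 * \<alpha> * t))"
    have inner: "(\<Sum>i<K + 2. w (k, j, b) i * ?v c t x ! i)
        = - 4 * pi^2 * (real k)^2 * \<alpha> * t + real j * \<eta> k * x + (if b then h * c k else 0)"
      if "k \<in> {1..K}" for k j b
    proof -
      have "(\<Sum>i<K + 2. w (k, j, b) i * ?v c t x ! i) =
        (\<Sum>i<K + 2. (if i = K then - 4 * pi^2 * (real k)^2 * \<alpha> * t else 0)
          + (if i = K + 1 then real j * \<eta> k * x else 0) + (if i = k - 1 then if b then h * c k else 0 else 0))"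
        unfolding dot using that by (intro sum.cong) (auto simp: w_def)
      then show ?thesis
        using that by (auto simp add: sum.distrib sum.delta)
    qed
    have "(\<Sum>i\<in>I. a i * exp (\<Sum>j<K + 2. w i j * ?v c t x ! j))
        = (\<Sum>k\<in>{1..K}. \<Sum>j<m. \<Sum>b\<in>UNIV. a (k, j, b) * exp (\<Sum>i<K + 2. w (k, j, b) i * ?v c t x ! i))"
      unfolding I_def sum.cartesian_product by (intro sum.cong refl) (simp only: split_beta prod.collapse)
    also have "\<dots> = (\<Sum>k\<in>{1..K}. E k * D k * S k)"
    proof (rule sum.cong[OF refl])
      fix k
      assume k: "k \<in> {1..K}"
      have "(\<Sum>b\<in>UNIV. a (k, j, b) * exp (\<Sum>i<K + 2. w (k, j, b) i * ?v c t x ! i))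
          = E k * D k * (A k j * exp (real j * \<eta> k * x))" for j
        unfolding inner[OF k] exp_add
        using h(1) by (simp add: UNIV_bool a_def E_def D_def diff_divide_distrib algebra_simps)
      then show "(\<Sum>j<m. \<Sum>b\<in>UNIV. a (k, j, b) * exp (\<Sum>i<K + 2. w (k, j, b) i * ?v c t x ! i))
          = E k * D k * S k"
        by (simp only: S_def sum_distrib_left)
    qed
    finally have sum_eq: "(\<Sum>i\<in>I. a i * exp (\<Sum>j<K + 2. w i j * ?v c t x ! j)) = (\<Sum>k\<in>{1..K}. E k * D k * S k)" .
    have "\<bar>?v c t x ! j\<bar> \<le> 2" if "j < K + 2" for j
      using c t x that by (subst nth[OF that]) auto
    then have 1: "\<bar>net_out net K c x t - (\<Sum>k\<in>{1..K}. E k * D k * S k)\<bar> \<le> \<delta> / 2"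
      unfolding net_out_def sum_eq[symmetric] by (intro net(4)) auto
    have "\<bar>(\<Sum>k\<in>{1..K}. E k * D k * S k) - (\<Sum>k=1..K. D k * c k * sin (2 * pi * real k * x))\<bar>
        \<le> (\<Sum>k=1..K. 3 * exp (6 * pi * real K - real m) + 4 * \<tau>)"
      unfolding sum_subtractf[symmetric]
    proof (rule order_trans[OF sum_abs], rule sum_mono)
      fix k
      assume k: "k \<in> {1..K}"
      define s where "s = sin (2 * pi * real k * x)"
      have D: "0 \<le> D k" "D k \<le> 1"
        using assms(4) t by (auto simp: D_def)
      have ck: "\<bar>c k\<bar> \<le> 2"
        using c k by blast
      have E: "\<bar>E k - c k\<bar> \<le> \<tau>"
        using h(2)[OF ck] by (simp add: E_def)
      have E3: "\<bar>E k\<bar> \<le> 3"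
        using E ck \<tau>(2) by linarith
      have "exp (3 * (2 * pi * real k) - real m) \<le> exp (6 * pi * real K - real m)"
        using k by simp
      moreover have "\<bar>s - S k\<bar> \<le> exp (3 * (2 * pi * real k) - real m) + \<tau>"
        using A x by (simp add: s_def S_def)
      ultimately have S: "\<bar>s - S k\<bar> \<le> exp (6 * pi * real K - real m) + \<tau>"
        by linarith
      \<comment> \<open>One factor is exchanged at a time: the coefficient error meets a sine of
        size at most 1, the sine error meets \<bar>E k\<bar> \<le> 3, and the heat factor only
        damps. This gives the constants 3 and 1 + 3 = 4.\<close>
      have "E k * D k * S k - D k * c k * s = D k * ((E k - c k) * s + E k * (S k - s))"
        by (simp add: algebra_simps)
      moreover have "\<bar>(E k - c k) * s\<bar> \<le> \<tau> * 1"
        unfolding abs_mult using E by (intro mult_mono) (auto simp: s_def)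
      moreover have "\<bar>E k * (S k - s)\<bar> \<le> 3 * (exp (6 * pi * real K - real m) + \<tau>)"
        unfolding abs_mult using E3 S by (intro mult_mono) (auto simp: abs_minus_commute)
      moreover have "\<bar>D k * z\<bar> \<le> \<bar>z\<bar>" for z
        using D by (simp add: abs_mult mult_left_le_one_le)
      ultimately show "\<bar>E k * D k * S k - D k * c k * sin (2 * pi * real k * x)\<bar>
          \<le> 3 * exp (6 * pi * real K - real m) + 4 * \<tau>"
        unfolding s_def[symmetric]
        by (smt (verit, best))
    qed
    also have "\<dots> \<le> 3 * real K * exp (6 * pi * real K - real m) + \<delta> / 2"
      using \<tau>(3) by (simp add: algebra_simps)
    finally show ?thesis
      using 1 unfolding D_def by linarith
  qed
  have "num_weights net = 2 * K * m * (K + 4) + 1"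
    using net(2) I(3) by (simp add: algebra_simps)
  then show ?thesis
    using net(1) cont approx by blast
qed

section \<open>Uniqueness of pointwise convergent sine series\<close>

text \<open>A Toeplitz-type theorem: weights that tend to 1 termwise and have uniformly bounded
  variation preserve the sum of a convergent series. Summation by parts moves the weights'
  differences onto the partial sums; far out these are close to s, and for the remaining finitely
  many indices the differences tend to 0.\<close>

lemma regular_summability:
  fixes A :: "nat \<Rightarrow> real" and w :: "'b \<Rightarrow> nat \<Rightarrow> real"
  assumes "A sums s"
    and w_lim: "\<And>k. ((\<lambda>h. w h k) \<longlongrightarrow> 1) F"
    and w_zero: "\<And>h. w h \<longlonglongrightarrow> 0"
    and var: "\<And>h n. (\<Sum>k<n. \<bar>w h k - w h (Suc k)\<bar>) \<le> V"
    and summ: "\<And>h. summable (\<lambda>k. A k * w h k)"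
  shows "((\<lambda>h. \<Sum>k. A k * w h k) \<longlongrightarrow> s) F"
proof -
  define T where "T n = (\<Sum>k<n. A k) - s" for n
  define R where "R h n = (\<Sum>k<n. T (Suc k) * (w h k - w h (Suc k)))" for h n
  have T: "T \<longlonglongrightarrow> 0"
    using assms(1) unfolding T_def sums_def by (simp add: LIM_zero)
  \<comment> \<open>\<open>T\<close> is the deviation of the partial sums from s. The boundary term
    vanishes as n grows because both of its factors do, so only \<open>R\<close> has to be
    estimated.\<close>
  have parts: "(\<Sum>k<n. A k * w h k) = s * w h 0 + T n * w h n + R h n" for h n
    by (induction n) (auto simp: T_def R_def algebra_simps)
  have R: "R h \<longlonglongrightarrow> (\<Sum>k. A k * w h k) - s * w h 0" for h
  proof -
    have "(\<lambda>n. (\<Sum>k<n. A k * w h k) - s * w h 0 - T n * w h n)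
        \<longlonglongrightarrow> (\<Sum>k. A k * w h k) - s * w h 0 - 0 * 0"
      by (intro tendsto_intros T w_zero summable_LIMSEQ summ)
    then show ?thesis
      by (simp add: parts)
  qed
  have "((\<lambda>h. (\<Sum>k. A k * w h k) - s * w h 0) \<longlongrightarrow> 0) F"
  proof (rule tendstoI)
    fix e :: real
    assume "e > 0"
    have "V \<ge> 0"
      using var[of _ 0] by simp
    define d where "d = e / 3 / (V + 1)"
    have d: "d > 0" "d * V < e / 3"
      using \<open>e > 0\<close> \<open>V \<ge> 0\<close> by (auto simp: d_def field_simps)
    obtain N where N: "\<And>n. n \<ge> N \<Longrightarrow> \<bar>T n\<bar> < d"
      using LIMSEQ_D[OF T d(1)] by auto
    have "((\<lambda>h. \<Sum>k<N. \<bar>T (Suc k) * (w h k - w h (Suc k))\<bar>) \<longlongrightarrow> (\<Sum>k<N. \<bar>T (Suc k) * (1 - 1)\<bar>)) F"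
      by (intro tendsto_intros w_lim)
    then have "\<forall>\<^sub>F h in F. (\<Sum>k<N. \<bar>T (Suc k) * (w h k - w h (Suc k))\<bar>) < e / 3"
      by (rule order_tendstoD(2)) (use \<open>e > 0\<close> in simp)
    then show "\<forall>\<^sub>F h in F. dist ((\<Sum>k. A k * w h k) - s * w h 0) 0 < e"
    proof eventually_elim
      case (elim h)
      have "\<bar>R h n\<bar> \<le> e / 3 + e / 3" for n
      proof -
        have "\<bar>R h n\<bar> \<le> (\<Sum>k<n. \<bar>T (Suc k) * (w h k - w h (Suc k))\<bar>)"
          unfolding R_def by (rule sum_abs)
        \<comment> \<open>The indices below \<open>N\<close> form a finite sum already made small by
          the choice of h; all others carry the factor d, leaving d times the total
          variation.\<close>
        also have "\<dots> \<le> (\<Sum>k<n. (if k < N then \<bar>T (Suc k) * (w h k - w h (Suc k))\<bar> else 0)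
            + d * \<bar>w h k - w h (Suc k)\<bar>)"
        proof (rule sum_mono)
          fix k
          show "\<bar>T (Suc k) * (w h k - w h (Suc k))\<bar> \<le> (if k < N then \<bar>T (Suc k) * (w h k - w h (Suc k))\<bar> else 0)
              + d * \<bar>w h k - w h (Suc k)\<bar>"
            using d(1) N[of "Suc k"] by (auto simp: abs_mult intro: mult_right_mono)
        qed
        also have "\<dots> = (\<Sum>k<n. if k < N then \<bar>T (Suc k) * (w h k - w h (Suc k))\<bar> else 0)
            + d * (\<Sum>k<n. \<bar>w h k - w h (Suc k)\<bar>)"
          by (simp add: sum.distrib sum_distrib_left)
        also have "(\<Sum>k<n. if k < N then \<bar>T (Suc k) * (w h k - w h (Suc k))\<bar> else 0)
            = (\<Sum>k\<in>{..<n} \<inter> {..<N}. \<bar>T (Suc k) * (w h k - w h (Suc k))\<bar>)"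
          by (simp add: sum.If_cases lessThan_def)
        also have "\<dots> \<le> (\<Sum>k<N. \<bar>T (Suc k) * (w h k - w h (Suc k))\<bar>)"
          by (intro sum_mono2) auto
        also have "d * (\<Sum>k<n. \<bar>w h k - w h (Suc k)\<bar>) \<le> d * V"
          using d(1) by (intro mult_left_mono var) auto
        finally show ?thesis
          using elim d(2) by linarith
      qed
      then have "\<bar>(\<Sum>k. A k * w h k) - s * w h 0\<bar> \<le> e / 3 + e / 3"
        by (intro LIMSEQ_le_const2[OF tendsto_rabs[OF R]]) auto
      then show ?case
        using \<open>e > 0\<close> by (simp add: dist_real_def)
    qed
  qed
  from tendsto_add[OF this tendsto_mult[OF tendsto_const[of s] w_lim[of 0]]]
  show ?thesis
    by simp
qed

text \<open>The square of sinc with its removable singularity filled. It is the multiplier by which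
  Riemann's second difference quotient of step h acts on the k-th term, at y = pi h k.\<close>

definition fejer_sinc :: "real \<Rightarrow> real" where
  "fejer_sinc y = (if y = 0 then 1 else (sin y / y)\<^sup>2)"

lemma fejer_sinc_tendsto: "(fejer_sinc \<longlongrightarrow> 1) (at 0)"
proof -
  have "((\<lambda>y. (sin (0 + y) - sin 0) / y) \<longlongrightarrow> cos 0) (at (0::real))"
    using DERIV_sin[of 0] unfolding DERIV_def .
  then have "((\<lambda>y. (sin y / y)\<^sup>2) \<longlongrightarrow> 1\<^sup>2) (at (0::real))"
    by (intro tendsto_power) simp
  then show ?thesis
    by (auto simp: fejer_sinc_def eventually_at_filter intro: Lim_transform_eventually)
qed

text \<open>The bound has the form 8 / (1 + y^2) because that is the derivative of 8 arctan, which
  makes the total variation finite. Up to 1, Taylor estimates give \<bar>y cos y - sin y\<bar> \<le>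
  y^2; beyond 1, the crude bound 2 y suffices and yields 4 / y^2.\<close>

lemma fejer_sinc_derivative:
  assumes "y > 0"
  shows "(fejer_sinc has_real_derivative 2 * (sin y / y) * ((cos y * y - sin y) / y\<^sup>2)) (at y)"
    and "\<bar>2 * (sin y / y) * ((cos y * y - sin y) / y\<^sup>2)\<bar> \<le> 8 / (1 + y\<^sup>2)"
proof -
  have "((\<lambda>y. (sin y / y)\<^sup>2) has_real_derivative 2 * (sin y / y) * ((cos y * y - sin y) / y\<^sup>2)) (at y)"
    using assms by (auto intro!: derivative_eq_intros simp: power2_eq_square) (simp add: field_simps)
  then show "(fejer_sinc has_real_derivative 2 * (sin y / y) * ((cos y * y - sin y) / y\<^sup>2)) (at y)"
    by (rule has_field_derivative_transform_within[where d = y])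
      (use assms in \<open>auto simp: fejer_sinc_def dist_real_def\<close>)
  have sin_abs: "\<bar>sin y\<bar> \<le> y" "\<bar>sin y\<bar> \<le> 1"
    using assms abs_sin_x_le_abs_x[of y] by auto
  have "2 * (\<bar>sin y\<bar> / y) * (\<bar>cos y * y - sin y\<bar> / y\<^sup>2) \<le> 8 / (1 + y\<^sup>2)"
  proof (cases "y \<le> 1")
    case True
    have "(\<Sum>m<Suc (Suc 0). sin_coeff m * y ^ m) = y"
      by (simp add: sin_coeff_Suc)
    moreover have "inverse (fact (Suc (Suc 0))) * \<bar>y\<bar> ^ Suc (Suc 0) = y\<^sup>2 / 2"
      by (simp add: power2_eq_square)
    ultimately have "\<bar>sin y - y\<bar> \<le> y\<^sup>2 / 2"
      using Maclaurin_sin_bound[of y "Suc (Suc 0)"] by (simp only:)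
    moreover have "\<bar>cos y * y - y\<bar> \<le> y\<^sup>2 / 2"
    proof -
      have "1 - cos y = 2 * (sin (y / 2))\<^sup>2"
        using cos_double_sin[of "y / 2"] by simp
      also have "\<dots> \<le> 2 * (y / 2)\<^sup>2"
        using abs_sin_x_le_abs_x[of "y / 2"] assms
          power_mono[of "\<bar>sin (y / 2)\<bar>" "y / 2" 2] by simp
      also have "\<dots> \<le> y / 2"
        using True assms by (simp add: power2_eq_square)
      finally have "1 - cos y \<le> y / 2" .
      then have "y * (1 - cos y) \<le> y * (y / 2)"
        using assms by (intro mult_left_mono) auto
      moreover have "y * (1 - cos y) \<ge> 0"
        using assms by simp
      ultimately show ?thesis
        by (simp add: algebra_simps power2_eq_square)
    qed
    ultimately have "\<bar>cos y * y - sin y\<bar> \<le> y\<^sup>2"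
      by linarith
    then have "\<bar>cos y * y - sin y\<bar> / y\<^sup>2 \<le> 1"
      using assms by simp
    moreover have "\<bar>sin y\<bar> / y \<le> 1"
      using sin_abs assms by simp
    ultimately have "2 * (\<bar>sin y\<bar> / y) * (\<bar>cos y * y - sin y\<bar> / y\<^sup>2) \<le> 2 * 1 * 1"
      using assms by (intro mult_mono) auto
    also have "\<dots> \<le> 8 / (1 + y\<^sup>2)"
      using True assms power_le_one[of y 2] by (simp add: pos_le_divide_eq add_pos_nonneg)
    finally show ?thesis .
  next
    case False
    have "\<bar>cos y * y\<bar> \<le> 1 * y"
      using assms unfolding abs_mult by (intro mult_mono) auto
    then have "\<bar>cos y * y - sin y\<bar> \<le> 2 * y"
      using sin_abs by linarith
    then have "\<bar>cos y * y - sin y\<bar> / y\<^sup>2 \<le> 2 * y / y\<^sup>2"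
      by (intro divide_right_mono) auto
    moreover have "\<bar>sin y\<bar> / y \<le> 1 / y"
      using assms sin_abs by (intro divide_right_mono) auto
    ultimately have "2 * (\<bar>sin y\<bar> / y) * (\<bar>cos y * y - sin y\<bar> / y\<^sup>2) \<le> 2 * (1 / y) * (2 * y / y\<^sup>2)"
      using assms by (intro mult_mono) auto
    also have "\<dots> = 8 / (y\<^sup>2 + y\<^sup>2)"
      using assms by (simp add: power2_eq_square)
    also have "\<dots> \<le> 8 / (1 + y\<^sup>2)"
      using False assms by (intro divide_left_mono) (auto simp: add_pos_pos one_le_power)
    finally show ?thesis .
  qed
  then show "\<bar>2 * (sin y / y) * ((cos y * y - sin y) / y\<^sup>2)\<bar> \<le> 8 / (1 + y\<^sup>2)"
    using assms by (simp add: abs_mult)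
qed

text \<open>Both 8 arctan + \<open>fejer_sinc\<close> and 8 arctan - \<open>fejer_sinc\<close> are
  nondecreasing on the positive axis.\<close>

lemma fejer_sinc_diff_le:
  assumes "0 < a" "a \<le> b"
  shows "\<bar>fejer_sinc a - fejer_sinc b\<bar> \<le> 8 * arctan b - 8 * arctan a"
proof -
  let ?d = "\<lambda>y::real. 2 * (sin y / y) * ((cos y * y - sin y) / y\<^sup>2)"
  have arctan: "((\<lambda>y. 8 * arctan y) has_real_derivative 8 / (1 + y\<^sup>2)) (at y)" for y
    by (auto intro!: derivative_eq_intros simp: divide_inverse)
  have "8 * arctan a + fejer_sinc a \<le> 8 * arctan b + fejer_sinc b"
  proof (rule DERIV_nonneg_imp_nondecreasing[OF assms(2)])
    fix y
    assume "a \<le> y"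
    then have "y > 0"
      using assms by simp
    show "\<exists>z. ((\<lambda>y. 8 * arctan y + fejer_sinc y) has_real_derivative z) (at y) \<and> 0 \<le> z"
    proof (intro exI conjI)
      show "((\<lambda>y. 8 * arctan y + fejer_sinc y) has_real_derivative 8 / (1 + y\<^sup>2) + ?d y) (at y)"
        by (intro DERIV_add arctan fejer_sinc_derivative(1) \<open>y > 0\<close>)
      show "0 \<le> 8 / (1 + y\<^sup>2) + ?d y"
        using fejer_sinc_derivative(2)[OF \<open>y > 0\<close>] by (simp only: abs_le_iff) linarith
    qed
  qed
  moreover have "8 * arctan a - fejer_sinc a \<le> 8 * arctan b - fejer_sinc b"
  proof (rule DERIV_nonneg_imp_nondecreasing[OF assms(2)])
    fix y
    assume "a \<le> y"
    then have "y > 0"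
      using assms by simp
    show "\<exists>z. ((\<lambda>y. 8 * arctan y - fejer_sinc y) has_real_derivative z) (at y) \<and> 0 \<le> z"
    proof (intro exI conjI)
      show "((\<lambda>y. 8 * arctan y - fejer_sinc y) has_real_derivative 8 / (1 + y\<^sup>2) - ?d y) (at y)"
        by (intro DERIV_diff arctan fejer_sinc_derivative(1) \<open>y > 0\<close>)
      show "0 \<le> 8 / (1 + y\<^sup>2) - ?d y"
        using fejer_sinc_derivative(2)[OF \<open>y > 0\<close>] by (simp only: abs_le_iff) linarith
    qed
  qed
  ultimately show ?thesis
    by linarith
qed

text \<open>The arctan bounds telescope, and arctan grows by at most pi / 2 on the positive axis.
  The bound is independent of h, which is the uniformity that \<open>regular_summability\<close>
  asks for.\<close>

lemma fejer_sinc_variation: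
  assumes "h > 0"
  shows "(\<Sum>k<n. \<bar>fejer_sinc (h * real (Suc k)) - fejer_sinc (h * real (Suc (Suc k)))\<bar>) \<le> 4 * pi"
proof -
  have "(\<Sum>k<n. \<bar>fejer_sinc (h * real (Suc k)) - fejer_sinc (h * real (Suc (Suc k)))\<bar>)
      \<le> (\<Sum>k<n. 8 * arctan (h * real (Suc (Suc k))) - 8 * arctan (h * real (Suc k)))"
    using assms by (intro sum_mono fejer_sinc_diff_le) auto
  also have "\<dots> = 8 * arctan (h * real (Suc n)) - 8 * arctan (h * real (Suc 0))"
    by (rule sum_lessThan_telescope)
  also have "\<dots> \<le> 4 * pi"
  proof -
    have "arctan (h * real (Suc 0)) \<ge> 0"
      using assms by simp
    then show ?thesis
      using arctan_ubound[of "h * real (Suc n)"] by linarith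
  qed
  finally show ?thesis .
qed

lemma fejer_sinc_le:
  assumes "y > 0"
  shows "\<bar>fejer_sinc y\<bar> \<le> 1 / y\<^sup>2"
  using assms by (simp add: fejer_sinc_def power_divide divide_right_mono abs_square_le_1)

section \<open>Riemann's function and its symmetric second derivative\<close>

definition second_diff :: "(real \<Rightarrow> real) \<Rightarrow> real \<Rightarrow> real \<Rightarrow> real" where
  "second_diff F x h = F (x + h) + F (x - h) - 2 * F x"

text \<open>The formal second antiderivative of the sine series, whence the sign and the division by
  (2 pi k)^2. For bounded coefficients it converges absolutely and uniformly.\<close>

definition riemann_fun :: "(nat \<Rightarrow> real) \<Rightarrow> real \<Rightarrow> real" where
  "riemann_fun c x = (\<Sum>k. - c (Suc k) / (2 * pi * real (Suc k))\<^sup>2 * sin (2 * pi * real (Suc k) * x))"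

lemma summable_inverse_Suc_square: "summable (\<lambda>k. 1 / (real (Suc k))\<^sup>2)"
  using inverse_squares_sums by (simp add: sums_iff add.commute)

lemma riemann_fun_term_le:
  assumes "\<And>k. \<bar>c k\<bar> \<le> B"
  shows "\<bar>- c (Suc k) / (2 * pi * real (Suc k))\<^sup>2 * sin (2 * pi * real (Suc k) * x)\<bar> \<le> B * (1 / (real (Suc k))\<^sup>2)"
proof -
  have "1 \<le> 2 * pi"
    using pi_ge_two by linarith
  then have "1 * real (Suc k) \<le> 2 * pi * real (Suc k)"
    by (intro mult_right_mono) auto
  then have "(real (Suc k))\<^sup>2 \<le> (2 * pi * real (Suc k))\<^sup>2"
    by (intro power_mono) auto
  then have "\<bar>c (Suc k)\<bar> / (2 * pi * real (Suc k))\<^sup>2 \<le> B / (real (Suc k))\<^sup>2"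
    using assms[of "Suc k"] by (intro frac_le) auto
  then have "\<bar>c (Suc k)\<bar> / (2 * pi * real (Suc k))\<^sup>2 * \<bar>sin (2 * pi * real (Suc k) * x)\<bar> \<le> B / (real (Suc k))\<^sup>2 * 1"
    using assms[of "Suc k"] by (intro mult_mono) (auto intro!: divide_nonneg_nonneg)
  then show ?thesis
    by (simp add: abs_mult)
qed

lemma riemann_fun_uniform_limit:
  assumes "\<And>k. \<bar>c k\<bar> \<le> B"
  shows "uniform_limit UNIV
    (\<lambda>n x. \<Sum>k<n. - c (Suc k) / (2 * pi * real (Suc k))\<^sup>2 * sin (2 * pi * real (Suc k) * x)) (riemann_fun c) sequentially"
  unfolding riemann_fun_def
proof (rule Weierstrass_m_test)
  fix n :: nat and x :: real
  show "norm (- c (Suc n) / (2 * pi * real (Suc n))\<^sup>2 * sin (2 * pi * real (Suc n) * x)) \<le> B * (1 / (real (Suc n))\<^sup>2)"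
    using riemann_fun_term_le[OF assms, where k = n and x = x] by (simp only: real_norm_def)
  show "summable (\<lambda>k. B * (1 / (real (Suc k))\<^sup>2))"
    by (intro summable_mult summable_inverse_Suc_square)
qed

lemma continuous_on_riemann_fun:
  assumes "\<And>k. \<bar>c k\<bar> \<le> B"
  shows "continuous_on UNIV (riemann_fun c)"
  by (rule uniform_limit_theorem[OF _ riemann_fun_uniform_limit[OF assms]])
    (auto intro!: always_eventually continuous_intros)

text \<open>Riemann's first theorem for sine series: the second difference quotient of the
  integrated series is the original series with k-th weight \<open>fejer_sinc\<close> (pi h k), so
  regularity of that summation method gives the limit s.\<close>

lemma riemann_second_difference:
  assumes "\<And>k. \<bar>c k\<bar> \<le> B"
    and "(\<lambda>k. c (Suc k) * sin (2 * pi * real (Suc k) * x)) sums s"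
    and "\<And>n. h n > 0" "h \<longlonglongrightarrow> 0"
  shows "(\<lambda>n. second_diff (riemann_fun c) x (h n) / (h n)\<^sup>2) \<longlonglongrightarrow> s"
proof -
  let ?A = "\<lambda>k. c (Suc k) * sin (2 * pi * real (Suc k) * x)"
  let ?w = "\<lambda>n k. fejer_sinc (pi * h n * real (Suc k))"
  let ?t = "\<lambda>y k. - c (Suc k) / (2 * pi * real (Suc k))\<^sup>2 * sin (2 * pi * real (Suc k) * y)"
  have t: "?t y sums riemann_fun c y" for y
    unfolding riemann_fun_def
    by (intro summable_sums summable_comparison_test[OF _ summable_mult[OF summable_inverse_Suc_square, of B]])
      (use riemann_fun_term_le[OF assms(1)] in \<open>simp only: real_norm_def, fast\<close>)
  have eq: "(?t (x + h n) k + ?t (x - h n) k - 2 * ?t x k) / (h n)\<^sup>2 = ?A k * ?w n k" for n k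
  proof -
    define \<omega> where "\<omega> = 2 * pi * real (Suc k)"
    \<comment> \<open>Half of \<omega> h, so that the second difference of the sine contains cos (2
      y) - 1 = - 2 (sin y)^2 and division by \<omega>^2 h^2 = 4 y^2 leaves the squared sinc.\<close>
    define y where "y = pi * h n * real (Suc k)"
    have y: "y > 0" "\<omega> > 0" "\<omega> * h n = 2 * y"
      using assms(3)[of n] by (auto simp: y_def \<omega>_def)
    have h: "h n = 2 * y / \<omega>"
      using y(2,3) by (simp add: field_simps)
    have "sin (\<omega> * (x + h n)) + sin (\<omega> * (x - h n)) - 2 * sin (\<omega> * x) = 2 * sin (\<omega> * x) * (cos (2 * y) - 1)"
      by (simp add: distrib_left right_diff_distrib y(3) sin_add sin_diff)
    also have "\<dots> = - 4 * sin (\<omega> * x) * (sin y)\<^sup>2"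
      by (simp add: cos_double_sin)
    finally have *: "sin (\<omega> * (x + h n)) + sin (\<omega> * (x - h n)) - 2 * sin (\<omega> * x) = - 4 * sin (\<omega> * x) * (sin y)\<^sup>2" .
    have "?t (x + h n) k + ?t (x - h n) k - 2 * ?t x k
        = - c (Suc k) / \<omega>\<^sup>2 * (sin (\<omega> * (x + h n)) + sin (\<omega> * (x - h n)) - 2 * sin (\<omega> * x))"
      unfolding \<omega>_def[symmetric] by (simp only: right_diff_distrib distrib_left) simp
    also have "\<dots> / (h n)\<^sup>2 = c (Suc k) * sin (\<omega> * x) * fejer_sinc y"
      unfolding * unfolding h fejer_sinc_def using y(1,2)
      by (simp add: power_divide power_mult_distrib)
    also have "\<dots> = ?A k * ?w n k"
      by (simp only: \<omega>_def y_def)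
    finally show ?thesis .
  qed
  have sums: "(\<lambda>k. ?A k * ?w n k) sums (second_diff (riemann_fun c) x (h n) / (h n)\<^sup>2)" for n
    unfolding eq[symmetric] second_diff_def by (intro sums_divide sums_diff sums_add sums_mult t)
  have "((\<lambda>n. \<Sum>k. ?A k * ?w n k) \<longlongrightarrow> s) sequentially"
  proof (rule regular_summability[OF assms(2)])
    fix k
    have "filterlim (\<lambda>n. pi * h n * real (Suc k)) (at 0) sequentially"
      unfolding filterlim_at using assms(3)[THEN less_imp_neq, symmetric]
      by (auto intro!: tendsto_eq_intros assms(4) simp del: of_nat_Suc)
    then show "(\<lambda>n. ?w n k) \<longlonglongrightarrow> 1"
      by (rule filterlim_compose[OF fejer_sinc_tendsto])
  next
    fix n
    show "(\<Sum>k<m. \<bar>?w n k - ?w n (Suc k)\<bar>) \<le> 4 * pi" for m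
      using fejer_sinc_variation[of "pi * h n"] assms(3)[of n] by simp
    show "summable (\<lambda>k. ?A k * ?w n k)"
      using sums by (rule sums_summable)
    have "(\<lambda>k. 1 / (pi * h n)\<^sup>2 * (1 / (real (Suc k))\<^sup>2)) \<longlonglongrightarrow> 1 / (pi * h n)\<^sup>2 * 0"
      by (intro tendsto_intros summable_LIMSEQ_zero summable_inverse_Suc_square)
    moreover have "\<bar>?w n k\<bar> \<le> 1 / (pi * h n)\<^sup>2 * (1 / (real (Suc k))\<^sup>2)" for k
      using fejer_sinc_le[of "pi * h n * real (Suc k)"] assms(3)[of n]
      by (simp add: power_mult_distrib del: of_nat_Suc)
    ultimately show "?w n \<longlonglongrightarrow> 0"
      by (intro Lim_null_comparison[of "?w n"]) (auto simp del: of_nat_Suc)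
  qed
  then show ?thesis
    using sums by (simp add: sums_iff)
qed

section \<open>A maximum principle for second differences with an exceptional null set\<close>

text \<open>At each interior point a single step h per \<eta> is enough. If W were positive
  somewhere, subtracting \<eta> y (1 - y) would leave a function with an interior maximum, yet with
  a second difference above \<eta> h^2 there, while at a maximum it is at most 0.\<close>

lemma second_diff_max_principle:
  assumes cont: "continuous_on {0..1} W"
    and bdry: "W 0 \<le> 0" "W 1 \<le> 0"
    and diff: "\<And>x \<eta>. x \<in> {0<..<1} \<Longrightarrow> \<eta> > 0 \<Longrightarrow>
      \<exists>h>0. x - h \<in> {0..1} \<and> x + h \<in> {0..1} \<and> second_diff W x h > - \<eta> * h\<^sup>2"
    and x: "x \<in> {0..1}"
  shows "W x \<le> 0"
proof (rule ccontr)
  assume "\<not> W x \<le> 0"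
  \<comment> \<open>Since y (1 - y) \<le> 1 on [0, 1], half of \<open>W x\<close> is a perturbation
    too small to destroy the positive value at x.\<close>
  define \<eta> where "\<eta> = W x / 2"
  have \<eta>: "\<eta> > 0" "\<eta> < W x"
    using \<open>\<not> W x \<le> 0\<close> by (auto simp: \<eta>_def)
  define Z where "Z y = W y - \<eta> * (y * (1 - y))" for y
  have "continuous_on {0..1} Z"
    unfolding Z_def by (intro continuous_intros cont)
  then obtain z where z: "z \<in> {0..1}" "\<And>y. y \<in> {0..1} \<Longrightarrow> Z y \<le> Z z"
    using continuous_attains_sup[of "{0..1::real}" Z] by auto
  have "x * (1 - x) \<le> 1 * 1"
    using x by (intro mult_mono) auto
  then have "Z x > 0"
    using \<eta> mult_left_mono[of "x * (1 - x)" "1 * 1" \<eta>] unfolding Z_def by linarith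
  then have "Z z > 0"
    using z(2)[OF x] by simp
  then have "z \<noteq> 0" "z \<noteq> 1"
    using bdry by (auto simp: Z_def)
  then have "z \<in> {0<..<1}"
    using z(1) by auto
  from diff[OF this \<eta>(1)] obtain h where h: "h > 0" "z - h \<in> {0..1}" "z + h \<in> {0..1}"
    "second_diff W z h > - \<eta> * h\<^sup>2"
    by blast
  have "second_diff Z z h = second_diff W z h + 2 * \<eta> * h\<^sup>2"
    by (simp add: second_diff_def Z_def algebra_simps power2_eq_square)
  moreover have "second_diff Z z h \<le> 0"
    using z(2)[OF h(2)] z(2)[OF h(3)] by (simp add: second_diff_def)
  moreover have "\<eta> * h\<^sup>2 > 0"
    using \<eta> h(1) by simp
  ultimately show False
    using h(4) by linarith
qed

text \<open>The second antiderivative of the indicator of V, written with the kernel max 0 (x - s):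
  a convex function whose second derivative on open V is 1.\<close>

definition indicator_potential :: "real set \<Rightarrow> real \<Rightarrow> real" where
  "indicator_potential V x = (\<integral>s. indicator V s * max 0 (x - s) \<partial>lborel)"

context
  fixes V :: "real set"
  assumes V: "open V" "V \<subseteq> {0..1}"
begin

lemma indicator_potential_integrable: "integrable lborel (\<lambda>s. indicator V s * max 0 (x - s))"
proof (rule Bochner_Integration.integrable_bound)
  show "integrable lborel (\<lambda>s. indicator {0..1::real} s * (\<bar>x\<bar> + 1))"
    by simp
  show "(\<lambda>s. indicator V s * max 0 (x - s)) \<in> borel_measurable lborel"
    by (intro borel_measurable_times borel_measurable_indicator borel_measurable_max) (use V(1) in auto)
  show "AE s in lborel. norm (indicator V s * max 0 (x - s)) \<le> norm (indicator {0..1} s * (\<bar>x\<bar> + 1))"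
    using V(2) by (intro AE_I2) (auto simp: indicator_def split: if_splits)
qed

lemma measure_lborel_subset_unit: "measure lborel V \<le> 1" "integrable lborel (indicator V :: real \<Rightarrow> real)"
proof -
  have "emeasure lborel V \<le> emeasure lborel {0..1::real}"
    using V(2) by (intro emeasure_mono) auto
  then have fin: "emeasure lborel V \<le> 1"
    by simp
  then show "measure lborel V \<le> 1"
    by (metis emeasure_eq_ennreal_measure ennreal_1 ennreal_le_iff infinity_ennreal_def
        linorder_not_le not_one_le_zero order_le_less_trans top.not_eq_extremum zero_le_one ennreal_one_less_top)
  show "integrable lborel (indicator V :: real \<Rightarrow> real)"
    using V(1) fin by (auto simp: integrable_indicator_iff order_le_less_trans)
qed

text \<open>The kernel lies between 0 and 1 for s in [0, 1] and x \<le> 1. Bounding the potential by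
  the measure of V is what lets potentials of shrinking sets be summed.\<close>

lemma indicator_potential_bounds:
  assumes "x \<le> 1"
  shows "0 \<le> indicator_potential V x" "indicator_potential V x \<le> measure lborel V"
proof -
  show "0 \<le> indicator_potential V x"
    unfolding indicator_potential_def by (intro Bochner_Integration.integral_nonneg) auto
  have "indicator_potential V x \<le> (\<integral>s. indicator V s \<partial>lborel)"
    unfolding indicator_potential_def
    using V(2) assms
    by (intro integral_mono indicator_potential_integrable measure_lborel_subset_unit) (auto simp: indicator_def)
  then show "indicator_potential V x \<le> measure lborel V"
    by simp
qed

text \<open>The kernel is 1-Lipschitz in x, and V has measure at most 1.\<close>

lemma continuous_on_indicator_potential: "continuous_on UNIV (indicator_potential V)"
proof (rule lipschitz_on_continuous_on[where L = 1], rule lipschitz_onI)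
  fix x y :: real
  have "indicator_potential V x - indicator_potential V y
      = (\<integral>s. indicator V s * max 0 (x - s) - indicator V s * max 0 (y - s) \<partial>lborel)"
    unfolding indicator_potential_def
    by (intro Bochner_Integration.integral_diff[symmetric] indicator_potential_integrable)
  also have "\<bar>\<dots>\<bar> \<le> (\<integral>s. \<bar>indicator V s * max 0 (x - s) - indicator V s * max 0 (y - s)\<bar> \<partial>lborel)"
    by (rule integral_abs_bound)
  also have "\<dots> \<le> (\<integral>s. indicator V s * \<bar>x - y\<bar> \<partial>lborel)"
    by (intro integral_mono integrable_abs Bochner_Integration.integrable_diff indicator_potential_integrable
        integrable_mult_left measure_lborel_subset_unit)
      (auto simp: indicator_def)
  also have "\<dots> = measure lborel V * \<bar>x - y\<bar>"
    by simp
  also have "\<dots> \<le> 1 * \<bar>x - y\<bar>"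
    by (intro mult_right_mono measure_lborel_subset_unit) auto
  finally show "dist (indicator_potential V x) (indicator_potential V y) \<le> 1 * dist x y"
    by (simp add: dist_real_def)
qed simp

lemma second_diff_indicator_potential:
  "second_diff (indicator_potential V) x h =
    (\<integral>s. indicator V s * (max 0 (x + h - s) + max 0 (x - h - s) - 2 * max 0 (x - s)) \<partial>lborel)"
proof -
  have "second_diff (indicator_potential V) x h = (\<integral>s. indicator V s * max 0 (x + h - s)
      + indicator V s * max 0 (x - h - s) - 2 * (indicator V s * max 0 (x - s)) \<partial>lborel)"
    unfolding second_diff_def indicator_potential_def
    by (subst Bochner_Integration.integral_diff Bochner_Integration.integral_add;
        (intro Bochner_Integration.integrable_add integrable_mult_right indicator_potential_integrable)?)+
      (simp add: indicator_potential_integrable)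
  then show ?thesis
    by (simp add: algebra_simps)
qed

lemma second_diff_indicator_potential_nonneg:
  assumes "h \<ge> 0"
  shows "0 \<le> second_diff (indicator_potential V) x h"
  unfolding second_diff_indicator_potential using assms
  by (intro Bochner_Integration.integral_nonneg mult_nonneg_nonneg) (auto simp: max_def)

text \<open>The second difference of the kernel is the tent h - \<bar>x - s\<bar> on \<bar>x -
  s\<bar> \<le> h. On the middle half, an interval of length h, it is at least h / 2.\<close>

lemma second_diff_indicator_potential_ge:
  assumes "h > 0" "{x - h..x + h} \<subseteq> V"
  shows "h\<^sup>2 / 2 \<le> second_diff (indicator_potential V) x h"
proof -
  have "(\<integral>s. indicator {x - h / 2..x + h / 2} s * (h / 2) \<partial>lborel)
      \<le> (\<integral>s. indicator V s * (max 0 (x + h - s) + max 0 (x - h - s) - 2 * max 0 (x - s)) \<partial>lborel)"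
  proof (rule integral_mono)
    show "integrable lborel (\<lambda>s. indicator {x - h / 2..x + h / 2} s * (h / 2))"
      using assms(1) by (intro integrable_mult_left) (simp add: integrable_indicator_iff)
    have "integrable lborel (\<lambda>s. indicator V s * max 0 (x + h - s) + indicator V s * max 0 (x - h - s)
        - 2 * (indicator V s * max 0 (x - s)))"
      by (intro Bochner_Integration.integrable_diff Bochner_Integration.integrable_add integrable_mult_right
          indicator_potential_integrable)
    then show "integrable lborel (\<lambda>s. indicator V s * (max 0 (x + h - s) + max 0 (x - h - s) - 2 * max 0 (x - s)))"
      by (simp add: algebra_simps)
    fix s
    show "indicator {x - h / 2..x + h / 2} s * (h / 2)
        \<le> indicator V s * (max 0 (x + h - s) + max 0 (x - h - s) - 2 * max 0 (x - s))"
    proof (cases "s \<in> {x - h / 2..x + h / 2}")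
      case True
      then have "s \<in> V"
        using assms by (intro subsetD[OF assms(2)]) auto
      then show ?thesis
        using True assms(1) by (auto simp: max_def)
    next
      case False
      have "0 \<le> max 0 (x + h - s) + max 0 (x - h - s) - 2 * max 0 (x - s)"
        using assms(1) by (auto simp: max_def)
      then show ?thesis
        using False by (simp add: zero_le_mult_iff)
    qed
  qed
  then show ?thesis
    using assms(1) unfolding second_diff_indicator_potential by (simp add: power2_eq_square)
qed

end

text \<open>N is covered by open sets of measure at most 2^(-n), and their potentials are added. The
  sum converges uniformly because each potential is bounded by the measure of its set, and at a
  point of N every set contributes second difference at least h^2 / 2 for small h, so the quotient
  exceeds every bound.\<close>

lemma null_set_convex_function:
  assumes "N \<in> null_sets lebesgue" "N \<subseteq> {0<..<1::real}"
  obtains U where "continuous_on {0..1} U"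
    "\<And>x h. x \<in> {0..1} \<Longrightarrow> x - h \<in> {0..1} \<Longrightarrow> x + h \<in> {0..1} \<Longrightarrow> h \<ge> 0 \<Longrightarrow> 0 \<le> second_diff U x h"
    "\<And>x m. x \<in> N \<Longrightarrow> \<forall>\<^sub>F h in at_right 0. m * h\<^sup>2 \<le> second_diff U x h"
proof -
  have "\<exists>T. open T \<and> N \<subseteq> T \<and> T \<subseteq> {0<..<1} \<and> measure lborel T \<le> (1 / 2) ^ n" for n
  proof -
    have N: "N \<in> sets lebesgue" "emeasure lebesgue N = 0"
      using assms(1) by (auto simp: null_sets_def)
    obtain T where T: "open T" "N \<subseteq> T" "T - N \<in> lmeasurable" "emeasure lebesgue (T - N) < ennreal ((1 / 2) ^ n)"
      by (rule sets_lebesgue_outer_open[OF N(1), of "(1 / 2) ^ n"]) auto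
    have "emeasure lborel (T \<inter> {0<..<1}) = emeasure lebesgue (T \<inter> {0<..<1})"
      using T(1) by simp
    also have "\<dots> \<le> emeasure lebesgue T"
      using T(1) by (intro emeasure_mono) auto
    also have "\<dots> = emeasure lebesgue (T - N)"
      using T assms(1) by (subst emeasure_Diff_null_set) auto
    also have "\<dots> \<le> ennreal ((1 / 2) ^ n)"
      using T(4) by simp
    finally have "measure lborel (T \<inter> {0<..<1}) \<le> (1 / 2) ^ n"
      unfolding measure_def by (intro enn2real_leI) auto
    then show ?thesis
      using T(1,2) assms(2) by (intro exI[of _ "T \<inter> {0<..<1}"]) auto
  qed
  then obtain T where T: "\<And>n. open (T n)" "\<And>n. N \<subseteq> T n" "\<And>n. T n \<subseteq> {0<..<1::real}"
    "\<And>n. measure lborel (T n) \<le> (1 / 2) ^ n"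
    by metis
  have T01: "T n \<subseteq> {0..1}" for n
    using T(3)[of n] by auto
  define U where "U x = (\<Sum>n. indicator_potential (T n) x)" for x
  have bound: "norm (indicator_potential (T n) x) \<le> (1 / 2) ^ n" if "x \<in> {0..1}" for n x
    using indicator_potential_bounds[OF T(1) T01, of x n] that T(4)[of n] by auto
  have geo: "summable (\<lambda>n. (1 / 2 :: real) ^ n)"
    by (intro summable_geometric) auto
  have sums: "(\<lambda>n. indicator_potential (T n) x) sums U x" if "x \<in> {0..1}" for x
    unfolding U_def by (intro summable_sums summable_comparison_test[OF _ geo]) (use bound that in auto)
  have "uniform_limit {0..1} (\<lambda>n x. \<Sum>i<n. indicator_potential (T i) x) U sequentially"
    unfolding U_def by (rule Weierstrass_m_test[OF bound geo])
  then have cont: "continuous_on {0..1} U"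
    by (rule uniform_limit_theorem[rotated])
      (auto intro!: always_eventually continuous_intros continuous_on_subset[OF continuous_on_indicator_potential] T(1) T01)
  have sd: "(\<lambda>n. second_diff (indicator_potential (T n)) x h) sums second_diff U x h"
    if "x \<in> {0..1}" "x - h \<in> {0..1}" "x + h \<in> {0..1}" for x h
    unfolding second_diff_def using that by (intro sums_diff sums_add sums_mult sums)
  show ?thesis
  proof (rule that[OF cont])
    fix x h :: real
    assume "x \<in> {0..1}" "x - h \<in> {0..1}" "x + h \<in> {0..1}" and "h \<ge> 0"
    from sd[OF this(1-3)] show "0 \<le> second_diff U x h"
      using second_diff_indicator_potential_nonneg[OF T(1) T01 \<open>h \<ge> 0\<close>]
      by (metis sums_iff suminf_nonneg)
  next
    fix x m :: real
    assume "x \<in> N"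
    \<comment> \<open>k sets contribute k h^2 / 2 \<ge> m h^2. Only finitely many sets are involved,
      so one range of small h serves all of them.\<close>
    obtain k :: nat where k: "2 * m \<le> real k"
      using real_arch_simple by blast
    have "\<forall>\<^sub>F h in at_right 0. {x - h..x + h} \<subseteq> T n" for n
    proof -
      obtain e where e: "e > 0" "cball x e \<subseteq> T n"
        using T(1,2) \<open>x \<in> N\<close> open_contains_cball by blast
      have "{x - h..x + h} \<subseteq> cball x e" if "h < e" for h
        using that by (auto simp: dist_real_def)
      then show ?thesis
        using e unfolding eventually_at_right_field by (intro exI[of _ e]) blast
    qed
    then have "\<forall>\<^sub>F h in at_right 0. \<forall>n\<in>{..k}. {x - h..x + h} \<subseteq> T n"
      by (intro eventually_ball_finite) auto
    moreover have "\<forall>\<^sub>F h in at_right 0. (0 :: real) < h"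
      by (rule eventually_at_right_less)
    ultimately show "\<forall>\<^sub>F h in at_right 0. m * h\<^sup>2 \<le> second_diff U x h"
    proof eventually_elim
      case (elim h)
      have "{x - h..x + h} \<subseteq> {0..1}"
        using elim(1) T01[of 0] by blast
      then have h01: "x \<in> {0..1}" "x - h \<in> {0..1}" "x + h \<in> {0..1}"
        using elim(2) by (auto elim!: subsetD)
      have "m * h\<^sup>2 \<le> (real k / 2) * h\<^sup>2"
        using k by (intro mult_right_mono) auto
      also have "\<dots> = (\<Sum>n<k. h\<^sup>2 / 2)"
        by simp
      also have "\<dots> \<le> (\<Sum>n<k. second_diff (indicator_potential (T n)) x h)"
        using elim by (intro sum_mono second_diff_indicator_potential_ge T(1) T01) auto
      also have "\<dots> \<le> second_diff U x h"
        unfolding sums_unique[OF sd[OF h01]] using elim(2)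
        by (intro sum_le_suminf sums_summable[OF sd[OF h01]])
          (auto intro!: second_diff_indicator_potential_nonneg[OF T(1) T01])
      finally show ?case .
    qed
  qed
qed

text \<open>The limit \<open>d\<close> need not vanish on \<open>N\<close>, but it is finite there, so the infinite second
  derivative of \<open>\<delta> U\<close> outweighs it; then \<open>\<delta>\<close> tends to zero.\<close>

lemma affine_if_second_diff_null:
  assumes H: "continuous_on {0..1} H"
    and N: "N \<in> null_sets lebesgue" "N \<subseteq> {0<..<1::real}"
    and h: "\<And>n. h n > 0" "h \<longlonglongrightarrow> 0"
    and lim: "\<And>x. x \<in> {0<..<1} \<Longrightarrow> (\<lambda>n. second_diff H x (h n) / (h n)\<^sup>2) \<longlonglongrightarrow> d x"
    and null: "\<And>x. x \<in> {0<..<1} - N \<Longrightarrow> d x = 0"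
    and x: "x \<in> {0..1}"
  shows "H x = H 0 + (H 1 - H 0) * x"
proof -
  obtain U where U: "continuous_on {0..1} U"
    "\<And>x h. x \<in> {0..1} \<Longrightarrow> x - h \<in> {0..1} \<Longrightarrow> x + h \<in> {0..1} \<Longrightarrow> h \<ge> 0 \<Longrightarrow> 0 \<le> second_diff U x h"
    "\<And>x m. x \<in> N \<Longrightarrow> \<forall>\<^sub>F h in at_right 0. m * h\<^sup>2 \<le> second_diff U x h"
    using null_set_convex_function[OF N] by blast
  have h_right: "filterlim h (at_right 0) sequentially"
    using h by (auto simp: filterlim_at less_imp_neq[OF h(1), symmetric] intro: always_eventually)
  \<comment> \<open>Both summands have their chord subtracted and vanish at 0 and 1, without a
    change of second differences. The sign \<sigma> gives the upper and the lower bound from one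
    argument.\<close>
  define P where "P \<sigma> \<delta> y = \<sigma> * (H y - (H 0 + (H 1 - H 0) * y)) + \<delta> * (U y - (U 0 + (U 1 - U 0) * y))" for \<sigma> \<delta> y
  have sdP: "second_diff (P \<sigma> \<delta>) y k = \<sigma> * second_diff H y k + \<delta> * second_diff U y k" for \<sigma> \<delta> y k
    by (simp add: second_diff_def P_def algebra_simps)
  have key: "P \<sigma> \<delta> x \<le> 0" if \<sigma>: "\<sigma> \<in> {-1, 1}" and \<delta>: "\<delta> > 0" for \<sigma> \<delta>
  proof (rule second_diff_max_principle[OF _ _ _ _ x])
    show "continuous_on {0..1} (P \<sigma> \<delta>)"
      unfolding P_def by (intro continuous_intros H U(1))
    show "P \<sigma> \<delta> 0 \<le> 0" "P \<sigma> \<delta> 1 \<le> 0"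
      by (simp_all add: P_def)
    fix y \<eta> :: real
    assume y: "y \<in> {0<..<1}" and \<eta>: "\<eta> > 0"
    have "\<forall>\<^sub>F n in sequentially. h n < min y (1 - y)"
      using y by (intro order_tendstoD(2)[OF h(2)]) auto
    then have small: "\<forall>\<^sub>F n in sequentially. y - h n \<in> {0..1} \<and> y + h n \<in> {0..1}"
      by eventually_elim (use h(1) in \<open>auto simp: less_imp_le add.commute intro: add_pos_pos\<close>, (smt (verit) h(1))+)
    have lim\<sigma>: "(\<lambda>n. \<sigma> * (second_diff H y (h n) / (h n)\<^sup>2)) \<longlonglongrightarrow> \<sigma> * d y"
      by (intro tendsto_intros lim y)
    \<comment> \<open>A lower bound for the second difference quotient of U. On N it is chosen to
      outweigh \<bar>d y\<bar>; off N the limit \<open>d y\<close> is 0 and convexity of U, that is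
      a = 0, suffices.\<close>
    define a where "a = (if y \<in> N then (\<bar>d y\<bar> + \<eta>) / \<delta> else 0)"
    have ad: "- \<eta> < \<sigma> * d y + a * \<delta>"
      using \<sigma> \<delta> \<eta> null[of y] y by (auto simp: a_def abs_if)
    have "\<forall>\<^sub>F n in sequentially. a * (h n)\<^sup>2 \<le> second_diff U y (h n)"
    proof (cases "y \<in> N")
      case True
      then show ?thesis
        using filterlim_iff[THEN iffD1, OF h_right] U(3) by blast
    next
      case False
      from small show ?thesis
        by eventually_elim (use False y h(1) in \<open>auto simp: a_def less_imp_le intro!: U(2)\<close>)
    qed
    moreover have "\<forall>\<^sub>F n in sequentially. \<sigma> * (second_diff H y (h n) / (h n)\<^sup>2) > - \<eta> - a * \<delta>"
      by (rule order_tendstoD(1)[OF lim\<sigma>]) (use ad in linarith)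
    ultimately have "\<forall>\<^sub>F n in sequentially. y - h n \<in> {0..1} \<and> y + h n \<in> {0..1} \<and>
        second_diff (P \<sigma> \<delta>) y (h n) > - \<eta> * (h n)\<^sup>2"
      using small
    proof eventually_elim
      case (elim n)
      have "(- \<eta> - a * \<delta>) * (h n)\<^sup>2 < \<sigma> * (second_diff H y (h n) / (h n)\<^sup>2) * (h n)\<^sup>2"
        using elim(2) h(1)[of n] by (intro mult_strict_right_mono) auto
      also have "\<dots> = \<sigma> * second_diff H y (h n)"
        using h(1)[of n] by simp
      finally have "- \<eta> * (h n)\<^sup>2 - \<delta> * (a * (h n)\<^sup>2) < \<sigma> * second_diff H y (h n)"
        by (simp add: algebra_simps)
      moreover have "\<delta> * (a * (h n)\<^sup>2) \<le> \<delta> * second_diff U y (h n)"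
        using elim(1) \<delta> by (intro mult_left_mono) auto
      ultimately show ?case
        using elim(3) by (simp add: sdP)
    qed
    then obtain n where "y - h n \<in> {0..1} \<and> y + h n \<in> {0..1} \<and> second_diff (P \<sigma> \<delta>) y (h n) > - \<eta> * (h n)\<^sup>2"
      using eventually_happens'[OF sequentially_bot] by blast
    then show "\<exists>k>0. y - k \<in> {0..1} \<and> y + k \<in> {0..1} \<and> second_diff (P \<sigma> \<delta>) y k > - \<eta> * k\<^sup>2"
      using h(1) by blast
  qed
  have "P \<sigma> 0 x \<le> 0" if "\<sigma> \<in> {-1, 1}" for \<sigma>
  proof (rule tendsto_upperbound)
    show "((\<lambda>\<delta>. P \<sigma> \<delta> x) \<longlongrightarrow> P \<sigma> 0 x) (at_right 0)"
      unfolding P_def by (intro tendsto_intros)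
    show "\<forall>\<^sub>F \<delta> in at_right 0. P \<sigma> \<delta> x \<le> 0"
      using eventually_at_right_less[of 0] by eventually_elim (use key that in blast)
  qed simp
  from this[of 1] this[of "-1"] show ?thesis
    by (simp add: P_def)
qed

section \<open>Orthogonality of sines and identification of the coefficients\<close>

lemma has_integral_cos_period:
  fixes m :: int
  assumes "m \<noteq> 0"
  shows "((\<lambda>x. cos (2 * pi * of_int m * x + \<phi>)) has_integral 0) {0..1::real}"
proof -
  let ?P = "\<lambda>x. sin (2 * pi * of_int m * x + \<phi>) / (2 * pi * of_int m)"
  have "((\<lambda>x. cos (2 * pi * of_int m * x + \<phi>)) has_integral ?P 1 - ?P 0) {0..1}"
    by (rule fundamental_theorem_of_calculus)
      (use assms in \<open>auto intro!: derivative_eq_intros simp flip: has_real_derivative_iff_has_vector_derivative\<close>)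
  moreover have "?P 1 - ?P 0 = 0"
    using sin_integer_2pi[of "of_int m"] cos_integer_2pi[of "of_int m"] by (simp add: sin_add)
  ultimately show ?thesis
    by (simp only:)
qed

text \<open>A common phase \<theta> is allowed because repeated integration by parts shifts sines by
  quarter periods. In the product-to-sum formula it cancels in the difference and is harmless in the
  sum, whose frequency is never 0.\<close>

lemma has_integral_sin_mult_sin:
  "((\<lambda>x. sin (2 * pi * real (Suc j) * x + \<theta>) * sin (2 * pi * real (Suc k) * x + \<theta>))
    has_integral (if j = k then 1 / 2 else 0)) {0..1::real}"
proof -
  let ?m = "int j - int k" and ?p = "int (Suc j) + int (Suc k)"
  have "((\<lambda>x. cos (2 * pi * of_int ?m * x + 0)) has_integral (if j = k then 1 else 0)) {0..1::real}"
    using has_integral_cos_period[of ?m 0] has_integral_const_real[of "1::real" 0 1] by (cases "j = k") auto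
  moreover have "((\<lambda>x. cos (2 * pi * of_int ?p * x + 2 * \<theta>)) has_integral 0) {0..1::real}"
    by (rule has_integral_cos_period) simp
  ultimately have "((\<lambda>x. (cos (2 * pi * of_int ?m * x + 0) - cos (2 * pi * of_int ?p * x + 2 * \<theta>)) / 2)
      has_integral ((if j = k then 1 else 0) - 0) / 2) {0..1}"
    by (intro has_integral_divide has_integral_diff)
  moreover have "(cos (2 * pi * of_int ?m * x + 0) - cos (2 * pi * of_int ?p * x + 2 * \<theta>)) / 2
      = sin (2 * pi * real (Suc j) * x + \<theta>) * sin (2 * pi * real (Suc k) * x + \<theta>)" for x
  proof -
    have "2 * pi * of_int ?m * x + 0 = (2 * pi * real (Suc j) * x + \<theta>) - (2 * pi * real (Suc k) * x + \<theta>)"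
      "2 * pi * of_int ?p * x + 2 * \<theta> = (2 * pi * real (Suc j) * x + \<theta>) + (2 * pi * real (Suc k) * x + \<theta>)"
      by (simp_all add: algebra_simps)
    then show ?thesis
      by (simp only: sin_times_sin)
  qed
  moreover have "((if j = k then 1 else 0) - 0) / 2 = (if j = k then 1 / 2 else (0::real))"
    by simp
  ultimately show ?thesis
    by (simp only:)
qed

lemma integral_sin_mult_sin:
  "integral {0..1} (\<lambda>x. sin (2 * pi * real (Suc j) * x + \<theta>) * sin (2 * pi * real (Suc k) * x + \<theta>))
    = (if j = k then 1 / 2 else 0)"
  by (rule integral_unique[OF has_integral_sin_mult_sin])

text \<open>The Cantor--Lebesgue argument: whenever \<open>\<bar>c k\<bar> \<ge> 1\<close>, the integral of the
  truncated square of the \<open>k\<close>-th term is at least \<open>1 / 2\<close>.\<close>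

lemma sine_series_bounded_coeffs:
  assumes "sine_series f c"
  obtains B where "\<And>k. \<bar>c k\<bar> \<le> B"
proof -
  define a where "a k x = c (Suc k) * sin (2 * pi * real (Suc k) * x)" for k x
  have a: "(\<lambda>k. a k x) \<longlonglongrightarrow> 0" if "x \<in> {0..1}" for x
    using assms that unfolding sine_series_def a_def by (intro summable_LIMSEQ_zero) (auto simp: sums_iff)
  have "(\<lambda>k. integral {0..1} (\<lambda>x. min 1 ((a k x)\<^sup>2))) \<longlonglongrightarrow> integral {0..1} (\<lambda>x::real. 0)"
  proof (rule dominated_convergence(2))
    show "(\<lambda>x. min 1 ((a k x)\<^sup>2)) integrable_on {0..1}" for k
      unfolding a_def by (intro integrable_continuous_real continuous_intros)
    show "(\<lambda>x::real. 1::real) integrable_on {0..1}"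
      by (intro integrable_continuous_real continuous_intros)
    show "norm (min 1 ((a k x)\<^sup>2)) \<le> 1" for k x
      by simp
    fix x :: real
    assume "x \<in> {0..1}"
    then have "(\<lambda>k. min 1 ((a k x)\<^sup>2)) \<longlonglongrightarrow> min 1 (0\<^sup>2)"
      by (intro tendsto_intros a)
    then show "(\<lambda>k. min 1 ((a k x)\<^sup>2)) \<longlonglongrightarrow> 0"
      by simp
  qed
  then have "\<forall>\<^sub>F k in sequentially. integral {0..1} (\<lambda>x. min 1 ((a k x)\<^sup>2)) < 1 / 2"
    by (intro order_tendstoD(2)) auto
  then have "\<forall>\<^sub>F k in sequentially. \<bar>c (Suc k)\<bar> < 1"
  proof eventually_elim
    case (elim k)
    show ?case
    proof (rule ccontr)
      assume "\<not> \<bar>c (Suc k)\<bar> < 1"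
      then have c: "1 \<le> (c (Suc k))\<^sup>2"
        using one_le_power[of "\<bar>c (Suc k)\<bar>" 2] by simp
      have "1 / 2 = integral {0..1} (\<lambda>x. sin (2 * pi * real (Suc k) * x) * sin (2 * pi * real (Suc k) * x))"
        using integral_sin_mult_sin[of k 0 k] by (simp only: add_0_right if_True refl)
      also have "\<dots> \<le> integral {0..1} (\<lambda>x. min 1 ((a k x)\<^sup>2))"
      proof (rule integral_le)
        show "(\<lambda>x. sin (2 * pi * real (Suc k) * x) * sin (2 * pi * real (Suc k) * x)) integrable_on {0..1}"
          "(\<lambda>x. min 1 ((a k x)\<^sup>2)) integrable_on {0..1}"
          unfolding a_def by (intro integrable_continuous_real continuous_intros)+
        fix x :: real
        have "1 * (sin (2 * pi * real (Suc k) * x))\<^sup>2 \<le> (c (Suc k))\<^sup>2 * (sin (2 * pi * real (Suc k) * x))\<^sup>2"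
          using c by (intro mult_right_mono) auto
        then show "sin (2 * pi * real (Suc k) * x) * sin (2 * pi * real (Suc k) * x) \<le> min 1 ((a k x)\<^sup>2)"
          unfolding a_def power_mult_distrib
          using abs_square_le_1[of "sin (2 * pi * real (Suc k) * x)"]
          by (simp only: power2_eq_square[symmetric] min.bounded_iff abs_sin_le_one) simp
      qed
      finally show False
        using elim by simp
    qed
  qed
  then obtain n where n: "\<And>k. k \<ge> n \<Longrightarrow> \<bar>c (Suc k)\<bar> < 1"
    unfolding eventually_sequentially by blast
  \<comment> \<open>From index n + 1 on, the coefficients are below 1; the finite sum covers the
    rest, including c 0, which does not enter the series.\<close>
  define B where "B = 1 + (\<Sum>k\<le>n. \<bar>c k\<bar>)"
  have B: "0 \<le> (\<Sum>k\<le>n. \<bar>c k\<bar>)"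
    by (intro sum_nonneg) auto
  have "\<bar>c k\<bar> \<le> B" for k
  proof (cases "k \<le> n")
    case True
    then have "\<bar>c k\<bar> \<le> (\<Sum>k\<le>n. \<bar>c k\<bar>)"
      by (intro member_le_sum) auto
    then show ?thesis
      by (simp add: B_def)
  next
    case False
    then obtain j where j: "k = Suc j" "j \<ge> n"
      by (cases k) auto
    then show ?thesis
      using n[OF j(2)] B unfolding B_def j(1) by linarith
  qed
  then show ?thesis
    by (rule that)
qed

text \<open>Subtracting the parabola g x * y^2 / 2 leaves a function whose second derivative g y - g
  x is small near x. The mean value theorem on each half, and once more between the two intermediate
  points, bounds its second difference by 2 k^2 times that oscillation.\<close>

lemma second_diff_antiderivative:
  assumes g: "continuous_on {0..1} g"
    and G1: "\<And>x. x \<in> {0..1} \<Longrightarrow> (G1 has_real_derivative g x) (at x within {0..1})"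
    and G: "\<And>x. x \<in> {0..1} \<Longrightarrow> (G has_real_derivative G1 x) (at x within {0..1})"
    and x: "x \<in> {0<..<1}"
    and h: "\<And>n. h n > 0" "h \<longlonglongrightarrow> 0"
  shows "(\<lambda>n. second_diff G x (h n) / (h n)\<^sup>2) \<longlonglongrightarrow> g x"
proof (rule tendstoI)
  fix e :: real
  assume "e > 0"
  then have "e / 3 > 0"
    by simp
  obtain \<delta> where \<delta>: "\<delta> > 0" "\<And>y. y \<in> {0..1} \<Longrightarrow> dist y x < \<delta> \<Longrightarrow> dist (g y) (g x) < e / 3"
    using g[unfolded continuous_on_iff, rule_format, of x "e / 3"] x \<open>e / 3 > 0\<close> by auto
  have "\<forall>\<^sub>F n in sequentially. h n < min \<delta> (min x (1 - x))"
    using x \<delta>(1) by (intro order_tendstoD(2)[OF h(2)]) auto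
  then show "\<forall>\<^sub>F n in sequentially. dist (second_diff G x (h n) / (h n)\<^sup>2) (g x) < e"
  proof eventually_elim
    case (elim n)
    define k where "k = h n"
    have k: "0 < k" "k < \<delta>" "k < x" "k < 1 - x"
      using elim h(1)[of n] by (auto simp: k_def)
    have at: "at y within {0..1} = at y" if "x - k \<le> y" "y \<le> x + k" for y
      using that k x by (intro at_within_interior) auto
    have mem: "y \<in> {0..1}" if "x - k \<le> y" "y \<le> x + k" for y
      using that k x by auto
    define Q where "Q y = G y - g x * y\<^sup>2 / 2" for y
    define Q1 where "Q1 y = G1 y - g x * y" for y
    have Q: "(Q has_real_derivative Q1 y) (at y)" if "x - k \<le> y" "y \<le> x + k" for y
      unfolding Q_def Q1_def using G[OF mem[OF that]] at[OF that]
      by (auto intro!: derivative_eq_intros)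
    have Q1: "(Q1 has_real_derivative g y - g x) (at y)" if "x - k \<le> y" "y \<le> x + k" for y
      unfolding Q1_def using G1[OF mem[OF that]] at[OF that]
      by (auto intro!: derivative_eq_intros)
    obtain u where u: "x < u" "u < x + k" "Q (x + k) - Q x = (x + k - x) * Q1 u"
      using MVT2[of x "x + k" Q Q1] Q k by auto
    obtain v where v: "x - k < v" "v < x" "Q x - Q (x - k) = (x - (x - k)) * Q1 v"
      using MVT2[of "x - k" x Q Q1] Q k by auto
    obtain z where z: "v < z" "z < u" "Q1 u - Q1 v = (u - v) * (g z - g x)"
      using MVT2[of v u Q1 "\<lambda>y. g y - g x"] Q1 u v by auto
    have "dist z x < \<delta>" "z \<in> {0..1}"
      using u v z k mem[of z] by (auto simp: dist_real_def)
    then have "\<bar>g z - g x\<bar> \<le> e / 3"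
      using \<delta>(2)[of z] by (simp add: dist_real_def)
    have "second_diff G x k - g x * k\<^sup>2 = (Q (x + k) - Q x) - (Q x - Q (x - k))"
      by (simp add: second_diff_def Q_def power2_eq_square algebra_simps add_divide_distrib diff_divide_distrib)
    also have "\<dots> = k * ((u - v) * (g z - g x))"
      unfolding u(3) v(3) z(3)[symmetric] by (simp add: algebra_simps)
    finally have eq: "second_diff G x k - g x * k\<^sup>2 = k * ((u - v) * (g z - g x))" .
    have "\<bar>second_diff G x k - g x * k\<^sup>2\<bar> = k * ((u - v) * \<bar>g z - g x\<bar>)"
      unfolding eq using k(1) u v by (simp add: abs_mult)
    also have "\<dots> \<le> k * ((2 * k) * (e / 3))"
      using k(1) u v \<open>\<bar>g z - g x\<bar> \<le> e / 3\<close> by (intro mult_left_mono mult_mono) auto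
    also have "\<dots> < e * k\<^sup>2"
      using k(1) \<open>e > 0\<close> by (simp add: power2_eq_square)
    finally have "\<bar>second_diff G x k - g x * k\<^sup>2\<bar> / k\<^sup>2 < e"
      using k(1) by (simp add: pos_divide_less_eq)
    moreover have "second_diff G x k / k\<^sup>2 - g x = (second_diff G x k - g x * k\<^sup>2) / k\<^sup>2"
      using k(1) by (simp add: diff_divide_distrib)
    ultimately show ?case
      by (simp add: dist_real_def flip: k_def)
  qed
qed

text \<open>Since F - G is affine, F is twice differentiable with second derivative g and vanishes
  at both ends. Two integrations by parts move the second derivative to the sine, and the uniformly
  convergent series for F can be integrated term by term.\<close>

lemma sine_coeff_eq_integral:
  assumes f: "sine_series f c" and g: "continuous_on {0..1} g"
    and N: "N \<in> null_sets lebesgue" "N \<subseteq> {0<..<1}"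
    and fg: "\<And>x. x \<in> {0<..<1} - N \<Longrightarrow> f x = g x"
  shows "integral {0..1} (\<lambda>x. g x * sin (2 * pi * real (Suc k) * x)) = c (Suc k) / 2"
proof -
  obtain B where B: "\<And>k. \<bar>c k\<bar> \<le> B"
    using sine_series_bounded_coeffs[OF f] by blast
  obtain G1 where G1: "\<And>x. x \<in> {0..1} \<Longrightarrow> (G1 has_real_derivative g x) (at x within {0..1})"
    using antiderivative_continuous[OF g] unfolding has_real_derivative_iff_has_vector_derivative by blast
  then have contG1: "continuous_on {0..1} G1"
    by (intro DERIV_continuous_on)
  obtain G where G: "\<And>x. x \<in> {0..1} \<Longrightarrow> (G has_real_derivative G1 x) (at x within {0..1})"
    using antiderivative_continuous[OF contG1] unfolding has_real_derivative_iff_has_vector_derivative by blast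
  then have contG: "continuous_on {0..1} G"
    by (intro DERIV_continuous_on)
  define F where "F = riemann_fun c"
  have contF: "continuous_on {0..1} F"
    unfolding F_def using continuous_on_riemann_fun[of c B, OF B] by (rule continuous_on_subset) simp
  have F01: "F 0 = 0" "F 1 = 0"
  proof -
    have "sin (2 * pi * real n) = 0" for n
      by (rule sin_integer_2pi) simp
    then show "F 0 = 0" "F 1 = 0"
      by (simp_all add: F_def riemann_fun_def del: of_nat_Suc)
  qed
  define h where "h n = 1 / real (Suc n)" for n
  have h: "h n > 0" "h \<longlonglongrightarrow> 0" for n
    unfolding h_def[abs_def] by (simp, rule LIMSEQ_Suc[OF lim_1_over_n])
  define a where "a = F 0 - G 0"
  define b where "b = F 1 - G 1 - (F 0 - G 0)"
  have FG: "F x = G x + (a + b * x)" if "x \<in> {0..1}" for x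
  proof -
    have "F x - G x = F 0 - G 0 + (F 1 - G 1 - (F 0 - G 0)) * x"
    proof (rule affine_if_second_diff_null[of "\<lambda>x. F x - G x" N h "\<lambda>x. f x - g x" x])
      fix x :: real
      assume x: "x \<in> {0<..<1}"
      have "(\<lambda>n. second_diff F x (h n) / (h n)\<^sup>2) \<longlonglongrightarrow> f x"
        unfolding F_def using f x
        by (intro riemann_second_difference[of c B, OF B _ h]) (auto simp: sine_series_def)
      moreover have "(\<lambda>n. second_diff G x (h n) / (h n)\<^sup>2) \<longlonglongrightarrow> g x"
        by (rule second_diff_antiderivative[OF g G1 G x h])
      ultimately have "(\<lambda>n. second_diff F x (h n) / (h n)\<^sup>2 - second_diff G x (h n) / (h n)\<^sup>2) \<longlonglongrightarrow> f x - g x"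
        by (rule tendsto_diff)
      moreover have "second_diff (\<lambda>x. F x - G x) x t = second_diff F x t - second_diff G x t" for t
        by (simp add: second_diff_def)
      ultimately show "(\<lambda>n. second_diff (\<lambda>x. F x - G x) x (h n) / (h n)\<^sup>2) \<longlonglongrightarrow> f x - g x"
        by (simp add: diff_divide_distrib)
    qed (use N h fg that in \<open>auto intro!: continuous_intros contF contG\<close>)
    then show ?thesis
      by (simp add: a_def b_def)
  qed
  define \<omega> where "\<omega> = 2 * pi * real (Suc k)"
  have \<omega>: "\<omega> > 0" "sin \<omega> = 0"
    using sin_integer_2pi[of "real (Suc k)"] by (auto simp: \<omega>_def)
  have contS: "continuous_on {0..1} (\<lambda>x. sin (\<omega> * x))"
    by (intro continuous_intros)
  \<comment> \<open>This is F' sin - F \<omega> cos with F replaced by G plus its affine part, so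
    that differentiability is evident. At 0 and 1 both the sine and F vanish.\<close>
  let ?P = "\<lambda>x. (G1 x + b) * sin (\<omega> * x) - \<omega> * (G x + (a + b * x)) * cos (\<omega> * x)"
  have "((\<lambda>x. g x * sin (\<omega> * x) + \<omega>\<^sup>2 * (F x * sin (\<omega> * x))) has_integral ?P 1 - ?P 0) {0..1}"
  proof (rule fundamental_theorem_of_calculus)
    fix x :: real
    assume x: "x \<in> {0..1}"
    have "(?P has_real_derivative g x * sin (\<omega> * x) + \<omega>\<^sup>2 * (F x * sin (\<omega> * x))) (at x within {0..1})"
      unfolding FG[OF x] using G1[OF x] G[OF x]
      by (auto intro!: derivative_eq_intros simp: algebra_simps power2_eq_square)
    then show "(?P has_vector_derivative g x * sin (\<omega> * x) + \<omega>\<^sup>2 * (F x * sin (\<omega> * x))) (at x within {0..1})"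
      by (simp only: has_real_derivative_iff_has_vector_derivative)
  qed simp
  moreover have "?P 1 - ?P 0 = 0"
    using FG[of 0] FG[of 1] F01 \<omega>(2) by simp
  ultimately have "integral {0..1} (\<lambda>x. g x * sin (\<omega> * x) + \<omega>\<^sup>2 * (F x * sin (\<omega> * x))) = 0"
    by (metis integral_unique)
  also have "integral {0..1} (\<lambda>x. g x * sin (\<omega> * x) + \<omega>\<^sup>2 * (F x * sin (\<omega> * x)))
      = integral {0..1} (\<lambda>x. g x * sin (\<omega> * x)) + \<omega>\<^sup>2 * integral {0..1} (\<lambda>x. F x * sin (\<omega> * x))"
    unfolding integral_mult_right[symmetric]
    by (intro Henstock_Kurzweil_Integration.integral_add integrable_continuous_real continuous_intros g contF)
  finally have parts: "integral {0..1} (\<lambda>x. g x * sin (\<omega> * x)) + \<omega>\<^sup>2 * integral {0..1} (\<lambda>x. F x * sin (\<omega> * x)) = 0" .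
  let ?t = "\<lambda>j x. - c (Suc j) / (2 * pi * real (Suc j))\<^sup>2 * sin (2 * pi * real (Suc j) * x)"
  have "uniform_limit {0..1} (\<lambda>n x. \<Sum>j<n. ?t j x) F sequentially"
    unfolding F_def by (rule uniform_limit_on_subset[OF riemann_fun_uniform_limit[of c B, OF B]]) simp
  then have "uniform_limit {0..1} (\<lambda>n x. (\<Sum>j<n. ?t j x) * sin (\<omega> * x)) (\<lambda>x. F x * sin (\<omega> * x)) sequentially"
    by (intro uniform_lim_mult uniform_limit_const compact_imp_bounded compact_continuous_image contF contS) auto
  then obtain I J where IJ: "\<And>n. ((\<lambda>x. (\<Sum>j<n. ?t j x) * sin (\<omega> * x)) has_integral I n) {0..1}"
    "((\<lambda>x. F x * sin (\<omega> * x)) has_integral J) {0..1}" "I \<longlonglongrightarrow> J"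
    by (rule uniform_limit_integral) (auto intro!: continuous_intros)
  \<comment> \<open>By orthogonality the integral no longer changes once the partial sum contains
    the k-th mode.\<close>
  have "I n = - c (Suc k) / \<omega>\<^sup>2 / 2" if "n > k" for n
  proof -
    have "((\<lambda>x. (\<Sum>j<n. ?t j x) * sin (\<omega> * x)) has_integral
        (\<Sum>j<n. - c (Suc j) / (2 * pi * real (Suc j))\<^sup>2 * (if j = k then 1 / 2 else 0))) {0..1}"
      unfolding sum_distrib_right mult.assoc \<omega>_def
      using has_integral_sin_mult_sin[of _ 0 k]
      by (intro has_integral_sum has_integral_mult_right) (simp_all only: add_0_right finite_lessThan mult.assoc)
    then have "I n = (\<Sum>j<n. - c (Suc j) / (2 * pi * real (Suc j))\<^sup>2 * (if j = k then 1 / 2 else 0))"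
      using IJ(1) has_integral_unique by blast
    also have "\<dots> = (\<Sum>j<n. if j = k then - c (Suc j) / (2 * pi * real (Suc j))\<^sup>2 / 2 else 0)"
      by (intro sum.cong) auto
    also have "\<dots> = - c (Suc k) / \<omega>\<^sup>2 / 2"
      using that by (simp add: \<omega>_def)
    finally show ?thesis .
  qed
  then have "\<forall>\<^sub>F n in sequentially. I n = - c (Suc k) / \<omega>\<^sup>2 / 2"
    by (intro eventually_mono[OF eventually_gt_at_top[of k]])
  then have "I \<longlonglongrightarrow> - c (Suc k) / \<omega>\<^sup>2 / 2"
    by (rule tendsto_eventually)
  then have "integral {0..1} (\<lambda>x. F x * sin (\<omega> * x)) = - c (Suc k) / \<omega>\<^sup>2 / 2"
    using IJ(2,3) LIMSEQ_unique integral_unique by metis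
  then show ?thesis
    using parts \<omega>(1) unfolding \<omega>_def[symmetric] by (simp add: field_simps)
qed

section \<open>Coefficients of Sobolev functions\<close>

text \<open>The integral of (\<psi> - \<Sum> 2 b e)^2 is nonnegative; the factor 2 normalizes sines
  of square norm 1 / 2.\<close>

lemma sine_bessel:
  fixes \<psi> :: "real \<Rightarrow> real"
  assumes \<psi>: "continuous_on {0..1} \<psi>"
  shows "(\<Sum>k<m. 2 * (integral {0..1} (\<lambda>x. \<psi> x * sin (2 * pi * real (Suc k) * x + \<theta>)))\<^sup>2)
    \<le> integral {0..1} (\<lambda>x. (\<psi> x)\<^sup>2)"
proof -
  define e where "e k x = sin (2 * pi * real (Suc k) * x + \<theta>)" for k x
  define b where "b k = integral {0..1} (\<lambda>x. \<psi> x * e k x)" for k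
  have cont: "continuous_on {0..1} (e k)" for k
    unfolding e_def by (intro continuous_intros)
  have sq: "((\<lambda>x. (\<psi> x)\<^sup>2) has_integral integral {0..1} (\<lambda>x. (\<psi> x)\<^sup>2)) {0..1}"
    by (intro integrable_integral integrable_continuous_real continuous_intros \<psi>)
  have b: "((\<lambda>x. \<psi> x * e k x) has_integral b k) {0..1}" for k
    unfolding b_def by (intro integrable_integral integrable_continuous_real continuous_intros \<psi> cont)
  have ee: "((\<lambda>x. e j x * e k x) has_integral (if j = k then 1 / 2 else 0)) {0..1}" for j k
    unfolding e_def by (rule has_integral_sin_mult_sin)
  have "((\<lambda>x. (\<psi> x)\<^sup>2 - (\<Sum>k<m. 4 * b k * (\<psi> x * e k x)) + (\<Sum>j<m. \<Sum>k<m. 4 * b j * b k * (e j x * e k x)))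
      has_integral (integral {0..1} (\<lambda>x. (\<psi> x)\<^sup>2) - (\<Sum>k<m. 4 * b k * b k)
        + (\<Sum>j<m. \<Sum>k<m. 4 * b j * b k * (if j = k then 1 / 2 else 0)))) {0..1}"
    by (intro has_integral_add has_integral_diff has_integral_sum has_integral_mult_right sq b ee) auto
  moreover have "(\<psi> x)\<^sup>2 - (\<Sum>k<m. 4 * b k * (\<psi> x * e k x)) + (\<Sum>j<m. \<Sum>k<m. 4 * b j * b k * (e j x * e k x))
      = (\<psi> x - (\<Sum>k<m. 2 * b k * e k x))\<^sup>2" for x
  proof -
    have "(\<Sum>k<m. 4 * b k * (\<psi> x * e k x)) = 2 * \<psi> x * (\<Sum>k<m. 2 * b k * e k x)"
      unfolding sum_distrib_left by (intro sum.cong) auto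
    moreover have "(\<Sum>j<m. \<Sum>k<m. 4 * b j * b k * (e j x * e k x)) = (\<Sum>k<m. 2 * b k * e k x)\<^sup>2"
      unfolding power2_eq_square sum_product by (intro sum.cong) auto
    ultimately show ?thesis
      by (simp add: power2_diff)
  qed
  ultimately have "((\<lambda>x. (\<psi> x - (\<Sum>k<m. 2 * b k * e k x))\<^sup>2) has_integral
      (integral {0..1} (\<lambda>x. (\<psi> x)\<^sup>2) - (\<Sum>k<m. 4 * b k * b k)
        + (\<Sum>j<m. \<Sum>k<m. 4 * b j * b k * (if j = k then 1 / 2 else 0)))) {0..1}"
    by (simp only:)
  then have "0 \<le> integral {0..1} (\<lambda>x. (\<psi> x)\<^sup>2) - (\<Sum>k<m. 4 * b k * b k)
        + (\<Sum>j<m. \<Sum>k<m. 4 * b j * b k * (if j = k then 1 / 2 else 0))"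
    by (rule has_integral_nonneg) auto
  also have "(\<Sum>j<m. \<Sum>k<m. 4 * b j * b k * (if j = k then 1 / 2 else 0)) = (\<Sum>j<m. 2 * b j * b j)"
  proof (intro sum.cong refl)
    fix j
    assume "j \<in> {..<m}"
    moreover have "(\<Sum>k<m. 4 * b j * b k * (if j = k then 1 / 2 else 0)) = (\<Sum>k<m. if j = k then 2 * b j * b k else 0)"
      by (intro sum.cong) auto
    ultimately show "(\<Sum>k<m. 4 * b j * b k * (if j = k then 1 / 2 else 0)) = 2 * b j * b j"
      by simp
  qed
  also have "(\<Sum>k<m. 4 * b k * b k) = (\<Sum>k<m. 2 * b k * b k) + (\<Sum>k<m. 2 * b k * b k)"
    unfolding sum.distrib[symmetric] by (intro sum.cong) auto
  finally have "(\<Sum>k<m. 2 * b k * b k) \<le> integral {0..1} (\<lambda>x. (\<psi> x)\<^sup>2)"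
    by linarith
  then show ?thesis
    by (simp add: b_def e_def power2_eq_square mult.assoc)
qed

text \<open>A derivative depends only on values near the point, so vanishing on an open set is
  inherited by every derivative. This removes the boundary terms at 0 and 1 below.\<close>

lemma C0r_vanish:
  assumes "C0r r \<phi>" "j \<le> r"
  obtains a b where "0 < a" "b < 1" "\<And>x. x < a \<or> b < x \<Longrightarrow> (deriv ^^ j) \<phi> x = 0"
proof -
  obtain a b where ab: "0 < a" "b < 1" "\<And>x. x \<notin> {a..b} \<Longrightarrow> \<phi> x = 0"
    using assms(1) unfolding C0r_def by blast
  have "(deriv ^^ j) \<phi> x = 0" if "x < a \<or> b < x" for x
    using that
  proof (induction j arbitrary: x)
    case 0
    then show ?case
      using ab(3) by auto
  next
    case (Suc j)
    have "\<forall>\<^sub>F y in nhds x. y \<in> {..<a} \<union> {b<..}"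
      using Suc.prems by (intro eventually_nhds_in_open) auto
    then have "\<forall>\<^sub>F y in nhds x. (deriv ^^ j) \<phi> y = 0"
      by eventually_elim (use Suc.IH in auto)
    then have "deriv ((deriv ^^ j) \<phi>) x = deriv (\<lambda>_. 0) x"
      by (intro deriv_cong_ev) auto
    then show ?case
      by simp
  qed
  with ab(1,2) show ?thesis
    by (rule that)
qed

lemma C0r_continuous:
  assumes "C0r r \<phi>" "j \<le> r"
  shows "continuous_on UNIV ((deriv ^^ j) \<phi>)"
proof (cases "j = r")
  case False
  then have "((deriv ^^ j) \<phi> has_real_derivative (deriv ^^ Suc j) \<phi> x) (at x)" for x
    using assms unfolding C0r_def by auto
  then show ?thesis
    by (intro DERIV_continuous_on)
qed (use assms in \<open>auto simp: C0r_def\<close>)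

text \<open>Writing cos z as sin (z + pi / 2) gives every step the same form, a factor - \<omega>
  and a phase shift of pi / 2, so no distinction by parity of j arises.\<close>

lemma C0r_integral_by_parts:
  assumes "C0r r \<phi>" "j \<le> r"
  shows "integral {0..1} (\<lambda>x. (deriv ^^ j) \<phi> x * sin (\<omega> * x + \<theta>))
    = (- \<omega>) ^ j * integral {0..1} (\<lambda>x. \<phi> x * sin (\<omega> * x + \<theta> + real j * (pi / 2)))"
  using assms(2)
proof (induction j arbitrary: \<theta>)
  case 0
  then show ?case
    by simp
next
  case (Suc j)
  let ?d = "(deriv ^^ j) \<phi>" and ?d1 = "(deriv ^^ Suc j) \<phi>"
  have d: "(?d has_real_derivative ?d1 x) (at x)" for x
    using assms(1) Suc.prems unfolding C0r_def by auto
  have cont: "continuous_on {0..1} ?d" "continuous_on {0..1} ?d1"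
    using C0r_continuous[OF assms(1), of j] C0r_continuous[OF assms(1), of "Suc j"] Suc.prems
    by (auto intro: continuous_on_subset simp del: funpow.simps)
  have bdry: "?d 0 = 0" "?d 1 = 0"
    using C0r_vanish[OF assms(1), of j] Suc.prems by (metis Suc_leD zero_less_one)+
  let ?P = "\<lambda>x. ?d x * sin (\<omega> * x + \<theta>)"
  have "((\<lambda>x. ?d1 x * sin (\<omega> * x + \<theta>) + \<omega> * (?d x * cos (\<omega> * x + \<theta>))) has_integral ?P 1 - ?P 0) {0..1}"
  proof (rule fundamental_theorem_of_calculus)
    fix x :: real
    have "(?P has_real_derivative ?d1 x * sin (\<omega> * x + \<theta>) + \<omega> * (?d x * cos (\<omega> * x + \<theta>))) (at x)"
      by (auto intro!: derivative_eq_intros d simp del: funpow.simps)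
    then show "(?P has_vector_derivative ?d1 x * sin (\<omega> * x + \<theta>) + \<omega> * (?d x * cos (\<omega> * x + \<theta>))) (at x within {0..1})"
      unfolding has_real_derivative_iff_has_vector_derivative[symmetric] by (rule has_field_derivative_at_within)
  qed simp
  then have "integral {0..1} (\<lambda>x. ?d1 x * sin (\<omega> * x + \<theta>) + \<omega> * (?d x * cos (\<omega> * x + \<theta>))) = 0"
    using bdry by (metis (no_types, lifting) diff_zero integral_unique mult_zero_left)
  also have "integral {0..1} (\<lambda>x. ?d1 x * sin (\<omega> * x + \<theta>) + \<omega> * (?d x * cos (\<omega> * x + \<theta>)))
      = integral {0..1} (\<lambda>x. ?d1 x * sin (\<omega> * x + \<theta>)) + \<omega> * integral {0..1} (\<lambda>x. ?d x * cos (\<omega> * x + \<theta>))"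
    unfolding integral_mult_right[symmetric]
    by (intro Henstock_Kurzweil_Integration.integral_add integrable_continuous_real continuous_intros cont)
  also have "(\<lambda>x. ?d x * cos (\<omega> * x + \<theta>)) = (\<lambda>x. ?d x * sin (\<omega> * x + (\<theta> + pi / 2)))"
    by (simp add: sin_add cos_add algebra_simps)
  finally have "integral {0..1} (\<lambda>x. ?d1 x * sin (\<omega> * x + \<theta>))
      = - \<omega> * integral {0..1} (\<lambda>x. ?d x * sin (\<omega> * x + (\<theta> + pi / 2)))"
    by linarith
  also have "\<dots> = - \<omega> * ((- \<omega>) ^ j * integral {0..1} (\<lambda>x. \<phi> x * sin (\<omega> * x + (\<theta> + pi / 2) + real j * (pi / 2))))"
    using Suc by simp
  also have "(\<lambda>x. \<phi> x * sin (\<omega> * x + (\<theta> + pi / 2) + real j * (pi / 2)))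
      = (\<lambda>x. \<phi> x * sin (\<omega> * x + \<theta> + real (Suc j) * (pi / 2)))"
    by (simp add: algebra_simps add_divide_distrib)
  finally show ?case
    by (simp only: power_Suc mult.assoc)
qed

text \<open>A squared triangle inequality through c. It takes the place of Minkowski's inequality in
  all L2 estimates, at the price of a factor 2 that the constants absorb.\<close>

lemma power2_diff_le: "(a - b)\<^sup>2 \<le> 2 * (a - c)\<^sup>2 + 2 * (b - c)\<^sup>2" for a b c :: real
proof -
  have "0 \<le> (a + b - 2 * c)\<^sup>2"
    by simp
  then show ?thesis
    by (simp add: power2_eq_square algebra_simps)
qed

section \<open>L2 limits and the continuous representative\<close>

lemma L2_norm01_power2:
  "(L2_norm01 g)\<^sup>2 = set_lebesgue_integral lborel {0..1} (\<lambda>x. (g x)\<^sup>2)"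
proof -
  have "0 \<le> set_lebesgue_integral lborel {0..1} (\<lambda>x. (g x)\<^sup>2)"
    unfolding set_lebesgue_integral_def by (intro Bochner_Integration.integral_nonneg) auto
  then show ?thesis
    by (simp add: L2_norm01_def)
qed

lemma set_integrable_power2_diff:
  assumes \<psi>: "continuous_on {0..1} \<psi>"
    and D: "set_borel_measurable lborel {0..1} D" "set_integrable lborel {0..1} (\<lambda>x. (D x)\<^sup>2)"
  shows "set_integrable lborel {0..1} (\<lambda>x::real. (\<psi> x - D x)\<^sup>2 :: real)"
proof (rule set_integrable_bound)
  show "set_integrable lborel {0..1} (\<lambda>x. 2 * (\<psi> x)\<^sup>2 + 2 * (D x)\<^sup>2)"
    by (intro set_integral_add set_integrable_mult_right D borel_integrable_atLeastAtMost' continuous_intros \<psi>)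
  have "set_borel_measurable lborel {0..1} \<psi>"
    using borel_integrable_atLeastAtMost'[OF \<psi>] unfolding set_integrable_def set_borel_measurable_def
    by (rule borel_measurable_integrable)
  then have "(\<lambda>x. (indicator {0..1} x *\<^sub>R \<psi> x - indicator {0..1} x *\<^sub>R D x)\<^sup>2) \<in> borel_measurable lborel"
    using D(1) unfolding set_borel_measurable_def by measurable
  also have "(\<lambda>x. (indicator {0..1} x *\<^sub>R \<psi> x - indicator {0..1} x *\<^sub>R D x)\<^sup>2)
      = (\<lambda>x. indicator {0..1} x *\<^sub>R (\<psi> x - D x)\<^sup>2)"
    by (auto simp: indicator_def)
  finally show "set_borel_measurable lborel {0..1} (\<lambda>x. (\<psi> x - D x)\<^sup>2)"
    unfolding set_borel_measurable_def .
  have "(\<psi> x - D x)\<^sup>2 \<le> 2 * (\<psi> x)\<^sup>2 + 2 * (D x)\<^sup>2" for x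
    using power2_diff_le[of "\<psi> x" "D x" 0] by simp
  then show "AE x in lborel. x \<in> {0..1} \<longrightarrow> norm ((\<psi> x - D x)\<^sup>2) \<le> norm (2 * (\<psi> x)\<^sup>2 + 2 * (D x)\<^sup>2)"
    by (intro AE_I2) auto
qed

lemma set_lborel_integral_continuous:
  assumes "continuous_on {0..1} f"
  shows "set_lebesgue_integral lborel {0..1} f = integral {0..1} (f :: real \<Rightarrow> real)"
  by (rule set_borel_integral_eq_integral(2)[OF borel_integrable_atLeastAtMost'[OF assms]])

text \<open>The variance of \<bar>p\<bar> on the unit interval is nonnegative.\<close>

lemma integral_abs_le:
  assumes "continuous_on {0..1} p"
  shows "(integral {0..1} (\<lambda>x. \<bar>p x\<bar>))\<^sup>2 \<le> integral {0..1} (\<lambda>x::real. (p x)\<^sup>2 :: real)"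
proof -
  define a where "a = integral {0..1} (\<lambda>x. \<bar>p x\<bar>)"
  have "((\<lambda>x. (p x)\<^sup>2 - 2 * a * \<bar>p x\<bar> + a\<^sup>2) has_integral integral {0..1} (\<lambda>x. (p x)\<^sup>2) - 2 * a * a + a\<^sup>2) {0..1}"
    using has_integral_const_real[of "a\<^sup>2" 0 1] unfolding a_def
    by (intro has_integral_add has_integral_diff has_integral_mult_right integrable_integral
        integrable_continuous_real continuous_intros assms) auto
  then have "0 \<le> integral {0..1} (\<lambda>x. (p x)\<^sup>2) - 2 * a * a + a\<^sup>2"
  proof (rule has_integral_nonneg)
    fix x
    have "(p x)\<^sup>2 - 2 * a * \<bar>p x\<bar> + a\<^sup>2 = (\<bar>p x\<bar> - a)\<^sup>2"
      by (simp add: power2_diff)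
    then show "0 \<le> (p x)\<^sup>2 - 2 * a * \<bar>p x\<bar> + a\<^sup>2"
      by simp
  qed
  then show ?thesis
    by (simp add: a_def power2_eq_square)
qed

text \<open>The one-dimensional Sobolev embedding: a function starting at 0 is bounded by the L1
  norm of its derivative, hence by the L2 norm. It upgrades L2 convergence of derivatives to uniform
  convergence.\<close>

lemma sup_le_integral_deriv:
  assumes q: "\<And>x. x \<in> {0..1} \<Longrightarrow> (q has_real_derivative p x) (at x within {0..1})"
    and p: "continuous_on {0..1} p" and "q 0 = 0" and x: "x \<in> {0..1}"
  shows "(q x)\<^sup>2 \<le> integral {0..1} (\<lambda>x. (p x)\<^sup>2)"
proof -
  have sub: "{0..x} \<subseteq> {0..1}"
    using x by auto
  have "(p has_integral q x - q 0) {0..x}"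
  proof (rule fundamental_theorem_of_calculus)
    fix y
    assume "y \<in> {0..x}"
    then show "(q has_vector_derivative p y) (at y within {0..x})"
      using q[of y] sub unfolding has_real_derivative_iff_has_vector_derivative
      by (meson has_vector_derivative_within_subset subsetD)
  qed (use x in simp)
  then have "q x = integral {0..x} p"
    using \<open>q 0 = 0\<close> by (simp add: integral_unique)
  also have "\<bar>\<dots>\<bar> \<le> integral {0..x} (\<lambda>x. \<bar>p x\<bar>)"
    using integral_norm_bound_integral[of p "{0..x}" "\<lambda>x. \<bar>p x\<bar>"] continuous_on_subset[OF p sub]
    by (auto intro!: integrable_continuous_real continuous_intros)
  also have "\<dots> \<le> integral {0..1} (\<lambda>x. \<bar>p x\<bar>)"
    using sub continuous_on_subset[OF p sub]
    by (intro integral_subset_le) (auto intro!: integrable_continuous_real continuous_intros p)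
  finally have "\<bar>q x\<bar>\<^sup>2 \<le> (integral {0..1} (\<lambda>x. \<bar>p x\<bar>))\<^sup>2"
    by (intro power_mono) auto
  then show ?thesis
    using integral_abs_le[OF p] by simp
qed

text \<open>On a bounded interval a uniform limit is also an L2 limit, so g and D have L2 distance
  0.\<close>

lemma L2_limit_unique:
  assumes \<phi>: "\<And>n. continuous_on {0..1} (\<phi> n)" and lim: "uniform_limit {0..1} \<phi> g sequentially"
    and D: "set_borel_measurable lborel {0..1} D" "set_integrable lborel {0..1} (\<lambda>x. (D x)\<^sup>2)"
    and L2: "(\<lambda>n. L2_norm01 (\<lambda>x. \<phi> n x - D x)) \<longlonglongrightarrow> 0"
  shows "AE x in lborel. x \<in> {0..1} \<longrightarrow> D x = g x"
proof -
  have g: "continuous_on {0..1} g"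
    by (rule uniform_limit_theorem[OF _ lim]) (auto intro: always_eventually \<phi>)
  let ?I = "set_lebesgue_integral lborel {0..1}"
  have "?I (\<lambda>x. (g x - D x)\<^sup>2) \<le> 0"
  proof (rule field_le_epsilon)
    fix e :: real
    assume "e > 0"
    have "(\<lambda>n. (L2_norm01 (\<lambda>x. \<phi> n x - D x))\<^sup>2) \<longlonglongrightarrow> 0\<^sup>2"
      by (intro tendsto_intros L2)
    then have "\<forall>\<^sub>F n in sequentially. (L2_norm01 (\<lambda>x. \<phi> n x - D x))\<^sup>2 < e / 4"
      by (rule order_tendstoD(2)) (use \<open>e > 0\<close> in simp)
    moreover have "sqrt (e / 4) > 0"
      using \<open>e > 0\<close> by simp
    then have "\<forall>\<^sub>F n in sequentially. \<forall>x\<in>{0..1}. dist (\<phi> n x) (g x) < sqrt (e / 4)"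
      by (rule uniform_limitD[OF lim])
    ultimately obtain n where n: "(L2_norm01 (\<lambda>x. \<phi> n x - D x))\<^sup>2 < e / 4"
      "\<And>x. x \<in> {0..1} \<Longrightarrow> dist (\<phi> n x) (g x) < sqrt (e / 4)"
      using eventually_happens'[OF sequentially_bot eventually_conj] by blast
    have "?I (\<lambda>x. (g x - D x)\<^sup>2) \<le> ?I (\<lambda>x. 2 * (e / 4) + 2 * (\<phi> n x - D x)\<^sup>2)"
    proof (rule set_integral_mono)
      show "set_integrable lborel {0..1} (\<lambda>x. (g x - D x)\<^sup>2)"
        by (rule set_integrable_power2_diff[OF g D])
      show "set_integrable lborel {0..1} (\<lambda>x. 2 * (e / 4) + 2 * (\<phi> n x - D x)\<^sup>2)"
        by (intro set_integral_add set_integrable_mult_right set_integrable_power2_diff[OF \<phi> D]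
            borel_integrable_atLeastAtMost' continuous_intros)
      fix x :: real
      assume "x \<in> {0..1}"
      then have "\<bar>g x - \<phi> n x\<bar> \<le> sqrt (e / 4)"
        using n(2)[of x] by (simp add: dist_real_def abs_minus_commute)
      then have "(g x - \<phi> n x)\<^sup>2 \<le> e / 4"
        using \<open>e > 0\<close> real_sqrt_le_iff real_sqrt_abs by metis
      then show "(g x - D x)\<^sup>2 \<le> 2 * (e / 4) + 2 * (\<phi> n x - D x)\<^sup>2"
        using power2_diff_le[of "g x" "D x" "\<phi> n x"] by (simp add: power2_commute)
    qed
    also have "\<dots> = ?I (\<lambda>x::real. 2 * (e / 4)) + ?I (\<lambda>x. 2 * (\<phi> n x - D x)\<^sup>2)"
    proof (rule set_integral_add(2))
      show "set_integrable lborel {0..1::real} (\<lambda>x. 2 * (e / 4))"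
        by (intro borel_integrable_atLeastAtMost' continuous_intros)
      show "set_integrable lborel {0..1} (\<lambda>x. 2 * (\<phi> n x - D x)\<^sup>2)"
        by (intro set_integrable_mult_right set_integrable_power2_diff[OF \<phi> D])
    qed
    also have "\<dots> \<le> 0 + e"
      using n(1) unfolding L2_norm01_power2 by (simp add: set_lebesgue_integral_def)
    finally show "?I (\<lambda>x. (g x - D x)\<^sup>2) \<le> 0 + e" .
  qed
  then have "(\<integral>x. indicator {0..1} x *\<^sub>R (g x - D x)\<^sup>2 \<partial>lborel) = 0"
    unfolding set_lebesgue_integral_def by (intro antisym Bochner_Integration.integral_nonneg) auto
  then have "AE x in lborel. indicator {0..1} x *\<^sub>R (g x - D x)\<^sup>2 = 0"
    using set_integrable_power2_diff[OF g D] unfolding set_integrable_def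
    by (subst (asm) integral_nonneg_eq_0_iff_AE) auto
  then show ?thesis
    by eventually_elim (auto simp: indicator_def split: if_splits)
qed

text \<open>As r \<ge> 1, the first derivatives of the approximating functions are L2-Cauchy, and by
  the Sobolev embedding the functions themselves are uniformly Cauchy. The factor 2 in the last
  claim stems from \<open>power2_diff_le\<close>.\<close>

lemma sobolev_W2_representative:
  assumes W: "sobolev_W2 r D" and "r \<ge> 1"
  obtains \<phi> g where "\<And>n. C0r r (\<phi> n)" "uniform_limit {0..1} \<phi> g sequentially"
    "AE x in lborel. x \<in> {0..1} \<longrightarrow> D 0 x = g x"
    "\<And>e. e > 0 \<Longrightarrow> \<forall>\<^sub>F n in sequentially.
      integral {0..1} (\<lambda>x. ((deriv ^^ r) (\<phi> n) x)\<^sup>2) \<le> 2 * (L2_norm01 (D r))\<^sup>2 + e"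
proof -
  obtain \<phi> where \<phi>: "\<And>n. C0r r (\<phi> n)"
    and L2: "\<And>j. j \<le> r \<Longrightarrow> (\<lambda>n. L2_norm01 (\<lambda>x. (deriv ^^ j) (\<phi> n) x - D j x)) \<longlonglongrightarrow> 0"
    using W unfolding sobolev_W2_def by blast
  have D: "set_borel_measurable lborel {0..1} (D j)" "set_integrable lborel {0..1} (\<lambda>x. (D j x)\<^sup>2)" if "j \<le> r" for j
    using W that unfolding sobolev_W2_def by auto
  let ?I = "set_lebesgue_integral lborel {0..1}"
  let ?d = "\<lambda>j n. (deriv ^^ j) (\<phi> n)"
  have cont: "continuous_on {0..1} (?d j n)" if "j \<le> r" for j n
    using C0r_continuous[OF \<phi> that] by (rule continuous_on_subset) simp
  have int: "set_integrable lborel {0..1} (\<lambda>x. (?d j n x - D j x)\<^sup>2)" if "j \<le> r" for j n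
    by (rule set_integrable_power2_diff[OF cont[OF that] D[OF that]])
  have L2': "(\<lambda>n. ?I (\<lambda>x. (?d j n x - D j x)\<^sup>2)) \<longlonglongrightarrow> 0" if "j \<le> r" for j
    using tendsto_power[OF L2[OF that], of 2] by (simp add: L2_norm01_power2)
  have diff: "integral {0..1} (\<lambda>x. (?d j n x - ?d j m x)\<^sup>2)
      \<le> 2 * ?I (\<lambda>x. (?d j n x - D j x)\<^sup>2) + 2 * ?I (\<lambda>x. (?d j m x - D j x)\<^sup>2)" if j: "j \<le> r" for j n m
  proof -
    have contd: "continuous_on {0..1} (\<lambda>x. (?d j n x - ?d j m x)\<^sup>2)"
      by (intro continuous_intros cont j)
    have "integral {0..1} (\<lambda>x. (?d j n x - ?d j m x)\<^sup>2) = ?I (\<lambda>x. (?d j n x - ?d j m x)\<^sup>2)"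
      by (rule set_lborel_integral_continuous[OF contd, symmetric])
    also have "\<dots> \<le> ?I (\<lambda>x. 2 * (?d j n x - D j x)\<^sup>2 + 2 * (?d j m x - D j x)\<^sup>2)"
      by (intro set_integral_mono set_integral_add set_integrable_mult_right int j
          borel_integrable_atLeastAtMost' contd power2_diff_le)
    also have "\<dots> = 2 * ?I (\<lambda>x. (?d j n x - D j x)\<^sup>2) + 2 * ?I (\<lambda>x. (?d j m x - D j x)\<^sup>2)"
      unfolding set_integral_mult_right[symmetric]
      by (intro set_integral_add set_integrable_mult_right int j)
    finally show ?thesis .
  qed
  have sup: "(\<phi> n x - \<phi> m x)\<^sup>2 \<le> integral {0..1} (\<lambda>x. (?d 1 n x - ?d 1 m x)\<^sup>2)" if "x \<in> {0..1}" for n m x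
  proof (rule sup_le_integral_deriv[OF _ _ _ that])
    have "\<phi> n 0 = 0" for n
      using C0r_vanish[OF \<phi>[of n], of 0] by (metis funpow_0 zero_le)
    then show "\<phi> n 0 - \<phi> m 0 = 0"
      by simp
    show "continuous_on {0..1} (\<lambda>x. ?d 1 n x - ?d 1 m x)"
      by (intro continuous_on_diff cont \<open>r \<ge> 1\<close>)
    have "(\<phi> n has_real_derivative ?d 1 n x) (at x within {0..1})" for n x
    proof -
      have "((deriv ^^ 0) (\<phi> n) has_real_derivative (deriv ^^ Suc 0) (\<phi> n) x) (at x)"
        using \<phi>[of n] \<open>r \<ge> 1\<close> unfolding C0r_def by auto
      then show ?thesis
        by (auto intro: has_field_derivative_at_within)
    qed
    then show "((\<lambda>x. \<phi> n x - \<phi> m x) has_real_derivative ?d 1 n x - ?d 1 m x) (at x within {0..1})" for x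
      by (intro DERIV_diff)
  qed
  have "uniformly_convergent_on {0..1} \<phi>"
  proof (rule Cauchy_uniformly_convergent, rule uniformly_Cauchy_onI)
    fix e :: real
    assume "e > 0"
    \<comment> \<open>Two such terms, each doubled in \<open>diff\<close>, add up to less than
      e^2.\<close>
    have "\<forall>\<^sub>F n in sequentially. ?I (\<lambda>x. (?d 1 n x - D 1 x)\<^sup>2) < e\<^sup>2 / 4"
      by (rule order_tendstoD(2)[OF L2'[OF \<open>r \<ge> 1\<close>]]) (use \<open>e > 0\<close> in simp)
    then obtain N where N: "\<And>n. n \<ge> N \<Longrightarrow> ?I (\<lambda>x. (?d 1 n x - D 1 x)\<^sup>2) < e\<^sup>2 / 4"
      unfolding eventually_sequentially by blast
    have "dist (\<phi> m x) (\<phi> n x) < e" if "x \<in> {0..1}" "m \<ge> N" "n \<ge> N" for x m n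
    proof -
      have "(\<phi> m x - \<phi> n x)\<^sup>2 < e\<^sup>2"
        using sup[OF that(1), of m n] diff[OF \<open>r \<ge> 1\<close>, of m n] N[OF that(2)] N[OF that(3)] by linarith
      then show ?thesis
        using \<open>e > 0\<close> power2_less_imp_less[of "\<bar>\<phi> m x - \<phi> n x\<bar>" e] by (simp add: dist_real_def)
    qed
    then show "\<exists>M. \<forall>x\<in>{0..1}. \<forall>m\<ge>M. \<forall>n\<ge>M. dist (\<phi> m x) (\<phi> n x) < e"
      by blast
  qed
  then obtain g where g: "uniform_limit {0..1} \<phi> g sequentially"
    unfolding uniformly_convergent_on_def by blast
  have ae: "AE x in lborel. x \<in> {0..1} \<longrightarrow> D 0 x = g x"
    using L2_limit_unique[OF _ g D[of 0]] cont[of 0] L2[of 0] by simp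
  show ?thesis
  proof (rule that[OF \<phi> g ae])
    fix e :: real
    assume "e > 0"
    have "\<forall>\<^sub>F n in sequentially. ?I (\<lambda>x. (?d r n x - D r x)\<^sup>2) < e / 2"
      by (rule order_tendstoD(2)[OF L2'[OF order_refl]]) (use \<open>e > 0\<close> in simp)
    then show "\<forall>\<^sub>F n in sequentially. integral {0..1} (\<lambda>x. (?d r n x)\<^sup>2) \<le> 2 * (L2_norm01 (D r))\<^sup>2 + e"
    proof eventually_elim
      case (elim n)
      have contd: "continuous_on {0..1} (\<lambda>x. (?d r n x)\<^sup>2)"
        by (intro continuous_intros cont) simp
      have "integral {0..1} (\<lambda>x. (?d r n x)\<^sup>2) = ?I (\<lambda>x. (?d r n x)\<^sup>2)"
        by (rule set_lborel_integral_continuous[OF contd, symmetric])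
      also have "\<dots> \<le> ?I (\<lambda>x. 2 * (?d r n x - D r x)\<^sup>2 + 2 * (D r x)\<^sup>2)"
      proof (rule set_integral_mono)
        show "(?d r n x)\<^sup>2 \<le> 2 * (?d r n x - D r x)\<^sup>2 + 2 * (D r x)\<^sup>2" for x
          using power2_diff_le[of "?d r n x" 0 "D r x"] by simp
      qed (intro set_integral_add set_integrable_mult_right int D borel_integrable_atLeastAtMost' contd order_refl)+
      also have "\<dots> = 2 * ?I (\<lambda>x. (?d r n x - D r x)\<^sup>2) + 2 * ?I (\<lambda>x. (D r x)\<^sup>2)"
        unfolding set_integral_mult_right[symmetric]
        by (intro set_integral_add set_integrable_mult_right int D order_refl)
      finally show ?case
        using elim by (simp add: L2_norm01_power2)
    qed
  qed
qed

text \<open>Bessel's inequality is applied to the approximating functions, where integration by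
  parts is legitimate, for finitely many modes, so that the limit can be taken termwise. The doubled
  norm bound gives 2, and the limits c / 2 of the sine integrals turn it into 4.\<close>

lemma admissible_coeff_bound:
  assumes adm: "admissible r f c" and "r \<ge> 1"
  shows "(\<Sum>k<m. ((2 * pi * real (Suc k)) ^ r * c (Suc k))\<^sup>2) \<le> 4"
proof -
  obtain D where f: "sine_series f c" and D: "D 0 = f" "sobolev_W2 r D" "L2_norm01 (D r) \<le> 1"
    using adm unfolding admissible_def by blast
  obtain \<phi> g where \<phi>: "\<And>n. C0r r (\<phi> n)" and g: "uniform_limit {0..1} \<phi> g sequentially"
    and ae: "AE x in lborel. x \<in> {0..1} \<longrightarrow> D 0 x = g x"
    and bound: "\<And>e. e > 0 \<Longrightarrow> \<forall>\<^sub>F n in sequentially.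
      integral {0..1} (\<lambda>x. ((deriv ^^ r) (\<phi> n) x)\<^sup>2) \<le> 2 * (L2_norm01 (D r))\<^sup>2 + e"
    by (rule sobolev_W2_representative[OF D(2) \<open>r \<ge> 1\<close>]) blast
  have cont\<phi>: "continuous_on {0..1} (\<phi> n)" for n
    using C0r_continuous[OF \<phi>[of n], of 0] by (auto intro: continuous_on_subset)
  have contg: "continuous_on {0..1} g"
    by (rule uniform_limit_theorem[OF _ g]) (auto intro: always_eventually cont\<phi>)
  define N where "N = {x \<in> {0<..<1}. f x \<noteq> g x}"
  obtain N0 where N0: "N0 \<in> null_sets lborel" "{x \<in> space lborel. \<not> (x \<in> {0..1} \<longrightarrow> D 0 x = g x)} \<subseteq> N0"
    using ae by (rule AE_E) (auto simp: null_sets_def)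
  have "N \<subseteq> N0"
    using N0(2) D(1) by (auto simp: N_def)
  then have N: "N \<in> null_sets lebesgue"
    using N0(1) by (blast intro: null_sets_completion_subset null_sets_completionI)
  have coeff: "integral {0..1} (\<lambda>x. g x * sin (2 * pi * real (Suc k) * x)) = c (Suc k) / 2" for k
    by (rule sine_coeff_eq_integral[OF f contg N]) (auto simp: N_def)
  define b where "b n k = integral {0..1} (\<lambda>x. \<phi> n x * sin (2 * pi * real (Suc k) * x))" for n k
  have b: "(\<lambda>n. b n k) \<longlonglongrightarrow> c (Suc k) / 2" for k
  proof -
    have "uniform_limit {0..1} (\<lambda>n x. \<phi> n x * sin (2 * pi * real (Suc k) * x))
        (\<lambda>x. g x * sin (2 * pi * real (Suc k) * x)) sequentially"
      by (intro uniform_lim_mult uniform_limit_const g compact_imp_bounded compact_continuous_image contg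
          continuous_intros) auto
    then obtain I J where IJ: "\<And>n. ((\<lambda>x. \<phi> n x * sin (2 * pi * real (Suc k) * x)) has_integral I n) {0..1}"
      "((\<lambda>x. g x * sin (2 * pi * real (Suc k) * x)) has_integral J) {0..1}" "I \<longlonglongrightarrow> J"
      by (rule uniform_limit_integral) (auto intro!: continuous_intros cont\<phi>)
    have "I n = b n k" for n
      unfolding b_def by (rule integral_unique[OF IJ(1), symmetric])
    then have "I = (\<lambda>n. b n k)"
      by blast
    moreover have "J = c (Suc k) / 2"
      using integral_unique[OF IJ(2)] coeff[of k] by simp
    ultimately show ?thesis
      using IJ(3) by (simp only:)
  qed
  have parts: "(\<Sum>k<m. 2 * ((2 * pi * real (Suc k)) ^ r * b n k)\<^sup>2)
      \<le> integral {0..1} (\<lambda>x. ((deriv ^^ r) (\<phi> n) x)\<^sup>2)" for n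
  proof -
    have "continuous_on {0..1} ((deriv ^^ r) (\<phi> n))"
      using C0r_continuous[OF \<phi>[of n] order_refl] by (rule continuous_on_subset) simp
    \<comment> \<open>The phase is chosen to cancel the shift r pi / 2 from integrating by parts r
      times, leaving plain sine coefficients; the sign of (- \<omega>)^r disappears in the
      square.\<close>
    from sine_bessel[OF this, where m = m and \<theta> = "- (real r * (pi / 2))"] show ?thesis
      unfolding C0r_integral_by_parts[OF \<phi>[of n] order_refl]
      by (simp add: b_def power_mult_distrib power_even_abs flip: power_mult)
  qed
  have "(\<Sum>k<m. 2 * ((2 * pi * real (Suc k)) ^ r * (c (Suc k) / 2))\<^sup>2) \<le> 2"
  proof (rule field_le_epsilon)
    fix e :: real
    assume "e > 0"
    have "(\<lambda>n. \<Sum>k<m. 2 * ((2 * pi * real (Suc k)) ^ r * b n k)\<^sup>2)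
        \<longlonglongrightarrow> (\<Sum>k<m. 2 * ((2 * pi * real (Suc k)) ^ r * (c (Suc k) / 2))\<^sup>2)"
      by (intro tendsto_intros b)
    moreover have "\<forall>\<^sub>F n in sequentially. (\<Sum>k<m. 2 * ((2 * pi * real (Suc k)) ^ r * b n k)\<^sup>2) \<le> 2 + e"
      using bound[OF \<open>e > 0\<close>]
    proof eventually_elim
      case (elim n)
      have "(L2_norm01 (D r))\<^sup>2 \<le> 1"
        using D(3) L2_norm01_def by (intro power_le_one) (auto simp: L2_norm01_def set_lebesgue_integral_def)
      then show ?case
        using elim parts[of n] by linarith
    qed
    ultimately show "(\<Sum>k<m. 2 * ((2 * pi * real (Suc k)) ^ r * (c (Suc k) / 2))\<^sup>2) \<le> 2 + e"
      by (rule tendsto_upperbound) simp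
  qed
  also have "(\<Sum>k<m. 2 * ((2 * pi * real (Suc k)) ^ r * (c (Suc k) / 2))\<^sup>2)
      = (\<Sum>k<m. ((2 * pi * real (Suc k)) ^ r * c (Suc k))\<^sup>2) / 2"
    unfolding sum_divide_distrib by (intro sum.cong) (simp_all add: power_mult_distrib power_divide)
  finally show ?thesis
    by simp
qed

section \<open>The heat equation\<close>

text \<open>By the inequality between arithmetic and geometric means, 2 \<bar>d\<bar> is at most (k
  d)^2 + 1 / k^2, and both are summable.\<close>

lemma summable_abs_if_weighted_squares_bounded:
  fixes d :: "nat \<Rightarrow> real"
  assumes "\<And>m. (\<Sum>k<m. (real (Suc k) * d k)\<^sup>2) \<le> B"
  shows "summable (\<lambda>k. \<bar>d k\<bar>)"
proof (rule summable_comparison_test')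
  have "summable (\<lambda>k. (real (Suc k) * d k)\<^sup>2)"
  proof (rule bounded_imp_summable)
    show "(\<Sum>k\<le>n. (real (Suc k) * d k)\<^sup>2) \<le> B" for n
      using assms[of "Suc n"] by (simp only: lessThan_Suc_atMost)
  qed simp
  then show "summable (\<lambda>k. (real (Suc k) * d k)\<^sup>2 + 1 / (real (Suc k))\<^sup>2)"
    using summable_inverse_Suc_square by (rule summable_add)
  fix k :: nat
  have "0 \<le> (real (Suc k) * \<bar>d k\<bar> - 1 / real (Suc k))\<^sup>2"
    by simp
  also have "\<dots> = (real (Suc k) * d k)\<^sup>2 + 1 / (real (Suc k))\<^sup>2 - 2 * \<bar>d k\<bar>"
    by (simp add: power2_diff power_mult_distrib power_divide del: of_nat_Suc)
  finally show "norm \<bar>d k\<bar> \<le> (real (Suc k) * d k)\<^sup>2 + 1 / (real (Suc k))\<^sup>2"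
    by simp
qed

text \<open>Parseval for the tail: absolute summability gives uniform convergence, so the squares of
  the finite tails can be integrated first. There the mixed terms vanish and each mode contributes
  half its squared coefficient.\<close>

lemma sine_tail_L2_bound:
  fixes d :: "nat \<Rightarrow> real"
  assumes d: "summable (\<lambda>k. \<bar>d k\<bar>)" and bound: "\<And>m. (\<Sum>k\<in>{K..<m}. (d k)\<^sup>2) \<le> B"
  defines "R \<equiv> \<lambda>x. (\<Sum>k. d k * sin (2 * pi * real (Suc k) * x)) - (\<Sum>k<K. d k * sin (2 * pi * real (Suc k) * x))"
  shows "continuous_on {0..1} R" "integral {0..1} (\<lambda>x. (R x)\<^sup>2) \<le> B / 2"
proof -
  let ?e = "\<lambda>k x. sin (2 * pi * real (Suc k) * x)"
  have "uniform_limit {0..1} (\<lambda>n x. \<Sum>k<n. d k * ?e k x) (\<lambda>x. \<Sum>k. d k * ?e k x) sequentially"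
    by (rule Weierstrass_m_test[OF _ d]) (auto simp: abs_mult mult_left_le)
  then have lim: "uniform_limit {0..1} (\<lambda>n x. (\<Sum>k<n. d k * ?e k x) - (\<Sum>k<K. d k * ?e k x)) R sequentially"
    unfolding R_def by (intro uniform_limit_intros)
  then show R: "continuous_on {0..1} R"
    by (rule uniform_limit_theorem[rotated]) (auto intro!: always_eventually continuous_intros)
  have "uniform_limit {0..1} (\<lambda>n x. ((\<Sum>k<n. d k * ?e k x) - (\<Sum>k<K. d k * ?e k x)) *
      ((\<Sum>k<n. d k * ?e k x) - (\<Sum>k<K. d k * ?e k x))) (\<lambda>x. R x * R x) sequentially"
    by (intro uniform_lim_mult lim compact_imp_bounded compact_continuous_image R) auto
  then obtain I J where IJ: "\<And>n. ((\<lambda>x. ((\<Sum>k<n. d k * ?e k x) - (\<Sum>k<K. d k * ?e k x)) *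
      ((\<Sum>k<n. d k * ?e k x) - (\<Sum>k<K. d k * ?e k x))) has_integral I n) {0..1}"
    "((\<lambda>x. R x * R x) has_integral J) {0..1}" "I \<longlonglongrightarrow> J"
    by (rule uniform_limit_integral) (auto intro!: continuous_intros)
  have "I n \<le> B / 2" if "n \<ge> K" for n
  proof -
    have "(\<Sum>k<n. d k * ?e k x) - (\<Sum>k<K. d k * ?e k x) = (\<Sum>k\<in>{K..<n}. d k * ?e k x)" for x
      using that by (simp add: lessThan_atLeast0 sum_diff_nat_ivl)
    then have "((\<lambda>x. \<Sum>j\<in>{K..<n}. \<Sum>k\<in>{K..<n}. d j * d k * (?e j x * ?e k x)) has_integral I n) {0..1}"
      using IJ(1)[of n] by (simp add: sum_product mult_ac)
    moreover have "((\<lambda>x. \<Sum>j\<in>{K..<n}. \<Sum>k\<in>{K..<n}. d j * d k * (?e j x * ?e k x)) has_integral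
        (\<Sum>j\<in>{K..<n}. \<Sum>k\<in>{K..<n}. d j * d k * (if j = k then 1 / 2 else 0))) {0..1}"
      using has_integral_sin_mult_sin[of _ 0]
      by (intro has_integral_sum has_integral_mult_right) (simp_all only: add_0_right finite_atLeastLessThan)
    ultimately have "I n = (\<Sum>j\<in>{K..<n}. \<Sum>k\<in>{K..<n}. d j * d k * (if j = k then 1 / 2 else 0))"
      by (rule has_integral_unique)
    also have "\<dots> = (\<Sum>j\<in>{K..<n}. (d j)\<^sup>2 / 2)"
    proof (intro sum.cong refl)
      fix j
      assume "j \<in> {K..<n}"
      moreover have "(\<Sum>k\<in>{K..<n}. d j * d k * (if j = k then 1 / 2 else 0))
          = (\<Sum>k\<in>{K..<n}. if j = k then d j * d k / 2 else 0)"
        by (intro sum.cong) auto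
      ultimately show "(\<Sum>k\<in>{K..<n}. d j * d k * (if j = k then 1 / 2 else 0)) = (d j)\<^sup>2 / 2"
        by (simp add: power2_eq_square)
    qed
    also have "\<dots> \<le> B / 2"
      using bound[of n] by (simp flip: sum_divide_distrib)
    finally show ?thesis .
  qed
  then have "J \<le> B / 2"
    by (intro LIMSEQ_le_const2[OF IJ(3)]) auto
  then show "integral {0..1} (\<lambda>x. (R x)\<^sup>2) \<le> B / 2"
    using IJ(2) by (simp add: power2_eq_square integral_unique)
qed

text \<open>The heat factors are at most 1, so the bounds for the initial coefficients persist for
  all t \<ge> 0. As 2 pi \<ge> 6, the weights in the tail are at least 36 K^(2 r), and 4 / 36 halved
  by \<open>sine_tail_L2_bound\<close> is 1 / 18.\<close>

lemma admissible_heat_tail: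
  assumes adm: "admissible r f c" and "r \<ge> 1" and "\<alpha> \<ge> 0" "t \<ge> 0" "K > 0"
  defines "R \<equiv> \<lambda>x. heat_sol \<alpha> c x t
    - (\<Sum>k=1..K. exp (- 4 * pi^2 * (real k)^2 * \<alpha> * t) * c k * sin (2 * pi * real k * x))"
  shows "continuous_on {0..1} R" "integral {0..1} (\<lambda>x. (R x)\<^sup>2) \<le> 1 / 18 / real K ^ (2 * r)"
    and "\<bar>c (Suc k)\<bar> \<le> 2"
proof -
  note coeff = admissible_coeff_bound[OF adm \<open>r \<ge> 1\<close>]
  define d where "d k = exp (- 4 * pi^2 * (real (Suc k))^2 * \<alpha> * t) * c (Suc k)" for k
  have dc: "\<bar>d k\<bar> \<le> \<bar>c (Suc k)\<bar>" for k
    using assms by (simp add: d_def abs_mult mult_left_le_one_le)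
  have six: "6 * real (Suc k) \<le> 2 * pi * real (Suc k)" for k
    using pi_gt3 by (intro mult_right_mono) auto
  have "\<bar>(real (Suc k) * d k)\<bar> \<le> \<bar>(2 * pi * real (Suc k)) ^ r * c (Suc k)\<bar>" for k
  proof -
    have "real (Suc k) \<le> 2 * pi * real (Suc k)"
      by (rule order_trans[OF _ six[of k]]) simp
    also have "\<dots> \<le> (2 * pi * real (Suc k)) ^ r"
      using six[of k] \<open>r \<ge> 1\<close> by (intro self_le_power) auto
    finally have "real (Suc k) * \<bar>d k\<bar> \<le> (2 * pi * real (Suc k)) ^ r * \<bar>c (Suc k)\<bar>"
      using dc[of k] by (intro mult_mono) auto
    then show ?thesis
      by (simp add: abs_mult power_abs)
  qed
  then have "(real (Suc k) * d k)\<^sup>2 \<le> ((2 * pi * real (Suc k)) ^ r * c (Suc k))\<^sup>2" for k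
    by (simp only: abs_le_square_iff)
  then have "(\<Sum>k<m. (real (Suc k) * d k)\<^sup>2) \<le> 4" for m
    by (intro order_trans[OF sum_mono coeff[of m]])
  then have summ: "summable (\<lambda>k. \<bar>d k\<bar>)"
    by (rule summable_abs_if_weighted_squares_bounded)
  have tail: "(\<Sum>k\<in>{K..<m}. (d k)\<^sup>2) \<le> 1 / 9 / real K ^ (2 * r)" for m
  proof -
    have "(36 * real K ^ (2 * r)) * (\<Sum>k\<in>{K..<m}. (d k)\<^sup>2) \<le> (\<Sum>k\<in>{K..<m}. ((2 * pi * real (Suc k)) ^ r * c (Suc k))\<^sup>2)"
      unfolding sum_distrib_left
    proof (rule sum_mono)
      fix k
      assume "k \<in> {K..<m}"
      then have "6 * real K \<le> 2 * pi * real (Suc k)"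
        using six[of k] by simp
      then have "(6 * real K) ^ r \<le> (2 * pi * real (Suc k)) ^ r"
        by (intro power_mono) auto
      moreover have "(6::real) * real K ^ r \<le> 6 ^ r * real K ^ r"
        using \<open>r \<ge> 1\<close> by (intro mult_right_mono self_le_power) auto
      ultimately have "6 * real K ^ r * \<bar>d k\<bar> \<le> (2 * pi * real (Suc k)) ^ r * \<bar>c (Suc k)\<bar>"
        using dc[of k] by (intro mult_mono) (auto simp: power_mult_distrib)
      then have "(6 * real K ^ r * \<bar>d k\<bar>)\<^sup>2 \<le> ((2 * pi * real (Suc k)) ^ r * \<bar>c (Suc k)\<bar>)\<^sup>2"
        by (intro power_mono) auto
      then show "36 * real K ^ (2 * r) * (d k)\<^sup>2 \<le> ((2 * pi * real (Suc k)) ^ r * c (Suc k))\<^sup>2"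
        by (simp add: power_mult_distrib power_mult[symmetric] mult.commute[of r])
    qed
    also have "\<dots> \<le> (\<Sum>k<m. ((2 * pi * real (Suc k)) ^ r * c (Suc k))\<^sup>2)"
      by (intro sum_mono2) auto
    also have "\<dots> \<le> 4"
      by (rule coeff)
    finally show ?thesis
      using \<open>K > 0\<close> by (simp add: field_simps)
  qed
  have "(\<Sum>k=1..K. exp (- 4 * pi^2 * (real k)^2 * \<alpha> * t) * c k * sin (2 * pi * real k * x))
      = (\<Sum>k<K. d k * sin (2 * pi * real (Suc k) * x))" for x
    unfolding d_def by (rule sum.reindex_bij_witness[of _ Suc "\<lambda>k. k - 1"]) auto
  then have "R = (\<lambda>x. (\<Sum>k. d k * sin (2 * pi * real (Suc k) * x)) - (\<Sum>k<K. d k * sin (2 * pi * real (Suc k) * x)))"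
    unfolding R_def heat_sol_def d_def by (simp only: mult.assoc)
  then show "continuous_on {0..1} R" "integral {0..1} (\<lambda>x. (R x)\<^sup>2) \<le> 1 / 18 / real K ^ (2 * r)"
    using sine_tail_L2_bound[OF summ tail] by simp_all
  show "\<bar>c (Suc k)\<bar> \<le> 2"
  proof -
    have "((2 * pi * real (Suc k)) ^ r * c (Suc k))\<^sup>2 \<le> (\<Sum>k<Suc k. ((2 * pi * real (Suc k)) ^ r * c (Suc k))\<^sup>2)"
      by (intro member_le_sum) auto
    also have "\<dots> \<le> 2\<^sup>2"
      using coeff[of "Suc k"] by simp
    finally have "\<bar>(2 * pi * real (Suc k)) ^ r * c (Suc k)\<bar> \<le> 2"
      by (simp only: abs_le_square_iff[symmetric] abs_numeral)
    moreover have "1 * \<bar>c (Suc k)\<bar> \<le> (2 * pi * real (Suc k)) ^ r * \<bar>c (Suc k)\<bar>"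
      using six[of k] by (intro mult_right_mono one_le_power) auto
    ultimately show ?thesis
      by (simp add: abs_mult power_abs)
  qed
qed

text \<open>The origin of 26 + r: pi \<le> 3.5 bounds 6 pi K by 21 K, and the remaining (5 + r) K
  splits into 4 K against the factor 12, K against the factor K, and r K against 1 / \<epsilon>
  \<le> K^r \<le> exp (r K).\<close>

lemma heat_net_error_budget:
  fixes \<epsilon> :: real
  assumes "0 < \<epsilon>" "r \<ge> 1" "\<epsilon> powr - (1 / real r) \<le> real K"
  shows "3 * real K * exp (6 * pi * real K - real ((26 + r) * K)) \<le> \<epsilon> / 4"
    and "1 / real K ^ (2 * r) \<le> \<epsilon>\<^sup>2" and "K > 0"
proof -
  have pos: "0 < \<epsilon> powr - (1 / real r)"
    using assms(1) by simp
  then have "real K > 0"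
    using assms(3) by linarith
  then show K: "K > 0"
    by simp
  have "(\<epsilon> powr - (1 / real r)) ^ r \<le> real K ^ r"
    using assms by (intro power_mono) auto
  moreover have "(\<epsilon> powr - (1 / real r)) ^ r = 1 / \<epsilon>"
  proof -
    have "(\<epsilon> powr - (1 / real r)) ^ r = \<epsilon> powr (- (1 / real r) * real r)"
      using powr_realpow[OF pos, of r] by (simp only: powr_powr)
    also have "- (1 / real r) * real r = - 1"
      using assms(2) by simp
    finally show ?thesis
      using assms(1) by (simp add: powr_minus_divide)
  qed
  ultimately have \<epsilon>: "1 / \<epsilon> \<le> real K ^ r"
    by simp
  then have "(1 / \<epsilon>)\<^sup>2 \<le> (real K ^ r)\<^sup>2"
    using assms(1) by (intro power_mono) auto
  then show "1 / real K ^ (2 * r) \<le> \<epsilon>\<^sup>2"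
    using assms(1) \<open>real K > 0\<close> by (simp add: power_divide field_simps flip: power_mult)
  have Kexp: "real K \<le> exp (real K)"
    using exp_ge_add_one_self[of "real K"] by linarith
  have "real K ^ r \<le> exp (real K) ^ r"
    using Kexp by (intro power_mono) auto
  then have "1 / \<epsilon> \<le> exp (real r * real K)"
    using \<epsilon> by (simp add: exp_of_nat_mult)
  have "(12::real) \<le> 2 ^ 4"
    by simp
  also have "\<dots> \<le> exp 1 ^ 4"
    using exp_ge_add_one_self[of 1] by (intro power_mono) auto
  also have "\<dots> = exp 4"
    by (simp flip: exp_of_nat_mult)
  also have "\<dots> \<le> exp (4 * real K)"
    using K by simp
  finally have "12 * real K * (1 / \<epsilon>) \<le> exp (4 * real K) * exp (real K) * exp (real r * real K)"
    using Kexp \<open>1 / \<epsilon> \<le> exp (real r * real K)\<close> assms(1) by (intro mult_mono) auto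
  also have "\<dots> = exp ((5 + real r) * real K)"
    by (simp add: algebra_simps flip: exp_add)
  finally have *: "12 * real K \<le> \<epsilon> * exp ((5 + real r) * real K)"
    using assms(1) by (simp add: field_simps)
  have "pi \<le> 3.5"
    using pi_less_4 pi_approx by simp
  then have "6 * pi * real K \<le> 21 * real K"
    by (intro mult_right_mono) auto
  then have "6 * pi * real K - real ((26 + r) * K) \<le> - ((5 + real r) * real K)"
    by (simp add: algebra_simps)
  then have "3 * real K * exp (6 * pi * real K - real ((26 + r) * K)) \<le> 3 * real K * exp (- ((5 + real r) * real K))"
    by (intro mult_left_mono) auto
  also have "\<dots> = 3 * real K / exp ((5 + real r) * real K)"
    by (simp only: exp_minus divide_inverse)
  also have "\<dots> \<le> \<epsilon> / 4"
    unfolding pos_divide_le_eq[OF exp_gt_zero] using * by linarith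
  finally show "3 * real K * exp (6 * pi * real K - real ((26 + r) * K)) \<le> \<epsilon> / 4" .
qed

theorem theorem4:
  fixes \<alpha> :: real and r :: nat
  assumes "\<alpha> > 0" and "r \<ge> 1"
  shows "\<exists>C cK. C > 0 \<and> cK > 0 \<and>
    (\<forall>\<epsilon>::real. 0 < \<epsilon> \<and> \<epsilon> < 1 \<longrightarrow>
      (\<exists>K net. real K \<ge> cK * \<epsilon> powr (-(1 / real r)) \<and>
         mlp_wf (K + 2) net \<and>
         real (num_weights net) \<le> C * (\<epsilon> powr (-(3 / real r)) +
             \<epsilon> powr (-(1 / real r)) * (ln (\<epsilon> powr (-(1 + 1 / real r))))^2) \<and>
         (\<forall>f c. admissible r f c \<longrightarrow>
            (\<forall>t\<in>{0..1}.
               set_integrable lborel {0..1} (\<lambda>x. (heat_sol \<alpha> c x t - net_out net K c x t)^2) \<and>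
               L2_norm01 (\<lambda>x. heat_sol \<alpha> c x t - net_out net K c x t) \<le> \<epsilon>))))"
proof (rule exI[of _ "88 * (26 + real r)"], rule exI[of _ 1], intro conjI allI impI)
  fix \<epsilon> :: real
  assume "0 < \<epsilon> \<and> \<epsilon> < 1"
  then have \<epsilon>: "0 < \<epsilon>" "\<epsilon> < 1"
    by auto
  define y where "y = \<epsilon> powr - (1 / real r)"
  have y: "y \<ge> 1"
    using \<epsilon> unfolding y_def powr_minus_divide
    by (simp add: powr_le1)
  \<comment> \<open>Rounding up at most doubles y because y \<ge> 1; its cube is the factor 8 in 88
    = 11 * 8.\<close>
  define K where "K = nat \<lceil>y\<rceil>"
  have K: "y \<le> real K" "real K \<le> 2 * y"
    using y unfolding K_def by linarith+
  note budget = heat_net_error_budget[OF \<epsilon>(1) assms(2) K(1)[unfolded y_def]]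
  define m where "m = (26 + r) * K"
  have "m > 0" "\<epsilon> / 4 > 0"
    using budget(3) \<epsilon> by (auto simp: m_def)
  from heat_net[OF budget(3) this less_imp_le[OF assms(1)]]
  obtain net where net: "mlp_wf (K + 2) net" "num_weights net = 2 * K * m * (K + 4) + 1"
    and cont: "\<And>c t. continuous_on UNIV (\<lambda>x. net_out net K c x t)"
    and approx: "\<And>c t x. \<forall>k\<in>{1..K}. \<bar>c k\<bar> \<le> 2 \<Longrightarrow> t \<in> {0..1} \<Longrightarrow> x \<in> {0..1} \<Longrightarrow>
      \<bar>net_out net K c x t - (\<Sum>k=1..K. exp (- 4 * pi^2 * (real k)^2 * \<alpha> * t) * c k * sin (2 * pi * real k * x))\<bar>
        \<le> 3 * real K * exp (6 * pi * real K - real m) + \<epsilon> / 4"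
    by blast
  show "\<exists>K net. real K \<ge> 1 * \<epsilon> powr (-(1 / real r)) \<and>
         mlp_wf (K + 2) net \<and>
         real (num_weights net) \<le> 88 * (26 + real r) * (\<epsilon> powr (-(3 / real r)) +
             \<epsilon> powr (-(1 / real r)) * (ln (\<epsilon> powr (-(1 + 1 / real r))))^2) \<and>
         (\<forall>f c. admissible r f c \<longrightarrow>
            (\<forall>t\<in>{0..1}.
               set_integrable lborel {0..1} (\<lambda>x. (heat_sol \<alpha> c x t - net_out net K c x t)^2) \<and>
               L2_norm01 (\<lambda>x. heat_sol \<alpha> c x t - net_out net K c x t) \<le> \<epsilon>))"
  proof (intro exI[of _ K] exI[of _ net] conjI allI impI ballI)
    show "1 * \<epsilon> powr - (1 / real r) \<le> real K"
      using K(1) by (simp add: y_def)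
    show "mlp_wf (K + 2) net"
      by (rule net(1))
    have K1: "real K \<ge> 1"
      using K(1) y by linarith
    have "real (num_weights net) = (26 + real r) * (2 * (real K * real K * (real K + 4))) + 1 * 1"
      by (simp add: net(2) m_def algebra_simps)
    \<comment> \<open>Since K \<ge> 1, K + 4 is at most 5 K, and the single output bias fits into
      one more multiple of K^3, so 2 * 5 + 1 = 11.\<close>
    also have "\<dots> \<le> (26 + real r) * (2 * (real K * real K * (5 * real K))) + (26 + real r) * real K ^ 3"
      using K1 by (intro add_mono mult_left_mono mult_mono one_le_power) auto
    also have "\<dots> = 11 * (26 + real r) * real K ^ 3"
      by (simp add: power3_eq_cube algebra_simps)
    also have "\<dots> \<le> 11 * (26 + real r) * (2 * y) ^ 3"
      using K(2) by (intro mult_left_mono power_mono) auto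
    also have "\<dots> = 88 * (26 + real r) * y ^ 3"
      by (simp add: power_mult_distrib)
    also have "y ^ 3 = \<epsilon> powr - (3 / real r)"
      using \<epsilon> by (simp add: y_def powr_powr flip: powr_realpow)
    also have "88 * (26 + real r) * \<epsilon> powr - (3 / real r) \<le> 88 * (26 + real r) * (\<epsilon> powr (-(3 / real r)) +
             \<epsilon> powr (-(1 / real r)) * (ln (\<epsilon> powr (-(1 + 1 / real r))))^2)"
      by (intro mult_left_mono) auto
    finally show "real (num_weights net) \<le> 88 * (26 + real r) * (\<epsilon> powr (-(3 / real r)) +
             \<epsilon> powr (-(1 / real r)) * (ln (\<epsilon> powr (-(1 + 1 / real r))))^2)" .
    fix f c t
    assume adm: "admissible r f c" and t: "t \<in> {0..1::real}"
    define S where "S x = (\<Sum>k=1..K. exp (- 4 * pi^2 * (real k)^2 * \<alpha> * t) * c k * sin (2 * pi * real k * x))" for x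
    define v where "v x = heat_sol \<alpha> c x t" for x
    define u where "u x = net_out net K c x t" for x
    have tail: "continuous_on {0..1} (\<lambda>x. v x - S x)" "integral {0..1} (\<lambda>x. (v x - S x)\<^sup>2) \<le> 1 / 18 / real K ^ (2 * r)"
      and ck: "\<bar>c (Suc k)\<bar> \<le> 2" for k
      using admissible_heat_tail[OF adm assms(2) less_imp_le[OF assms(1)] _ budget(3), of t] t
      unfolding S_def v_def by auto
    have "\<forall>k\<in>{1..K}. \<bar>c k\<bar> \<le> 2"
      using ck by (metis Suc_diff_1 atLeastAtMost_iff less_eq_Suc_le One_nat_def)
    then have err: "\<bar>u x - S x\<bar> \<le> \<epsilon> / 2" if "x \<in> {0..1}" for x
      using approx[OF _ t that, of c] budget(1) unfolding S_def u_def m_def by linarith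
    have contS: "continuous_on {0..1} S"
      unfolding S_def by (intro continuous_intros)
    have contu: "continuous_on {0..1} u"
      unfolding u_def using cont by (rule continuous_on_subset) simp
    \<comment> \<open>Continuity of the exact solution is available through its tail v - S, hence
      the detour over S.\<close>
    have "continuous_on {0..1} (\<lambda>x. (v x - S x) + (S x - u x))"
      by (intro continuous_on_add continuous_on_diff[of _ S] tail(1) contS contu)
    then have contvu: "continuous_on {0..1} (\<lambda>x. (v x - u x)\<^sup>2)"
      by (intro continuous_on_power) simp
    then show "set_integrable lborel {0..1} (\<lambda>x. (heat_sol \<alpha> c x t - net_out net K c x t)^2)"
      unfolding v_def u_def by (rule borel_integrable_atLeastAtMost')
    have "(L2_norm01 (\<lambda>x. v x - u x))\<^sup>2 = integral {0..1} (\<lambda>x. (v x - u x)\<^sup>2)"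
      unfolding L2_norm01_power2 by (rule set_lborel_integral_continuous[OF contvu])
    also have "\<dots> \<le> integral {0..1} (\<lambda>x. 2 * (v x - S x)\<^sup>2 + 2 * (\<epsilon> / 2)\<^sup>2)"
    proof (rule integral_le)
      fix x :: real
      assume "x \<in> {0..1}"
      then have "(u x - S x)\<^sup>2 \<le> (\<epsilon> / 2)\<^sup>2"
        using err[of x] power_mono[of "\<bar>u x - S x\<bar>" "\<epsilon> / 2" 2] by simp
      then show "(v x - u x)\<^sup>2 \<le> 2 * (v x - S x)\<^sup>2 + 2 * (\<epsilon> / 2)\<^sup>2"
        using power2_diff_le[of "v x" "u x" "S x"] by linarith
    qed (intro integrable_continuous_real contvu continuous_intros tail(1))+
    also have "\<dots> = integral {0..1} (\<lambda>x. 2 * (v x - S x)\<^sup>2) + integral {0..1} (\<lambda>x::real. 2 * (\<epsilon> / 2)\<^sup>2)"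
      by (intro Henstock_Kurzweil_Integration.integral_add integrable_continuous_real continuous_intros tail(1))
    also have "\<dots> = 2 * integral {0..1} (\<lambda>x. (v x - S x)\<^sup>2) + \<epsilon>\<^sup>2 / 2"
      by (simp add: power_divide)
    \<comment> \<open>The tail contributes 2 * \<epsilon>^2 / 18 and the network \<epsilon>^2 / 2,
      which together stay below \<epsilon>^2.\<close>
    also have "\<dots> \<le> \<epsilon>\<^sup>2"
    proof -
      have "1 / 18 / real K ^ (2 * r) = 1 / real K ^ (2 * r) / 18"
        by simp
      also have "\<dots> \<le> \<epsilon>\<^sup>2 / 18"
        by (intro divide_right_mono budget(2)) simp
      finally have "integral {0..1} (\<lambda>x. (v x - S x)\<^sup>2) \<le> \<epsilon>\<^sup>2 / 18"
        using tail(2) by (rule order_trans[rotated])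
      then show ?thesis
        using zero_le_power2[of \<epsilon>] by linarith
    qed
    finally have "(L2_norm01 (\<lambda>x. v x - u x))\<^sup>2 \<le> \<epsilon>\<^sup>2" .
    then have "L2_norm01 (\<lambda>x. v x - u x) \<le> \<epsilon>"
      by (rule power2_le_imp_le) (rule less_imp_le[OF \<epsilon>(1)])
    then show "L2_norm01 (\<lambda>x. heat_sol \<alpha> c x t - net_out net K c x t) \<le> \<epsilon>"
      by (simp only: v_def u_def)
  qed
qed (use assms in auto)

end
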